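(* Let $A,B\in\mathscr{B}(H)$ be bounded positive operators on the complex Hilbert space $H$. Let $\widehat{A}:=S_A^*S_A$ and $\widehat{B}:=S_B^*S_B$, where $S_A,S_B:H_{A+B}\to H$ are the contractions determined by $S_A((A+B)x)=A^{1/2}x$ and $S_B((A+B)x)=B^{1/2}x$, $x\in H$. Then $$A:B=J_{A+B}\widehat{A}(I-\widehat{A})J_{A+B}^*=J_{A+B}\widehat{B}(I-\widehat{B})J_{A+B}^*,$$ where $I$ is the identity operator of $H_{A+B}$.
   Context: Inner products are linear in the first variable. A bounded operator $A$ on $H$ is positive if $(Ax\mid x)\ge0$ for all $x\in H$. For a bounded positive operator $C$ on $H$, $H_C$ denotes the Hilbert space completion of $\operatorname{ran}C$ equipped with the inner product $(Cx\mid Cy)_C:=(Cx\mid y)$, $x,y\in H$, and $J_C:H_C\to H$ is the continuous extension of the embedding $\operatorname{ran}C\ni Cx\mapsto Cx\in H$; here $C=A+B$. The operators $S_A,S_B$, given on the dense subspace $\operatorname{ran}(A+B)$ of $H_{A+B}$, are contractive and extended by continuity to all of $H_{A+B}$. The parallel sum $A:B$ is the unique bounded positive operator on $H$ with quadratic form $$((A:B)x\mid x)=\inf\{(A(x-y)\mid x-y)+(By\mid y):y\in H\},\qquad x\in H.$$ *)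

theory Defs
  imports "HOL-Analysis.Analysis"
begin

section \<open>Complex Hilbert spaces\<close>

text \<open>
  A complex Hilbert space is presented on top of its underlying real Hilbert space, whose inner
  product is the real part of the complex one; the norm is therefore the one induced by
  \<open>cinner\<close>, and definiteness of \<open>cinner\<close> is inherited from \<^class>\<open>real_inner\<close>.
  The inner product is linear in the first variable.
\<close>

class complex_hilbert_space = real_inner + complete_space +
  fixes scaleC :: "complex \<Rightarrow> 'a \<Rightarrow> 'a"
    and cinner :: "'a \<Rightarrow> 'a \<Rightarrow> complex"
  assumes scaleC_add_right: "scaleC c (x + y) = scaleC c x + scaleC c y"
    and scaleC_add_left: "scaleC (c + d) x = scaleC c x + scaleC d x"
    and scaleC_scaleC: "scaleC c (scaleC d x) = scaleC (c * d) x"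
    and scaleC_of_real: "scaleC (complex_of_real r) x = scaleR r x"
    and cinner_commute: "cinner x y = cnj (cinner y x)"
    and cinner_add_left: "cinner (x + y) z = cinner x z + cinner y z"
    and cinner_scaleC_left: "cinner (scaleC c x) y = c * cinner x y"
    and inner_eq_Re_cinner: "inner x y = Re (cinner x y)"

instantiation complex :: complex_hilbert_space
begin
definition scaleC_complex :: "complex \<Rightarrow> complex \<Rightarrow> complex"
  where "scaleC_complex c x = c * x"
definition cinner_complex :: "complex \<Rightarrow> complex \<Rightarrow> complex"
  where "cinner_complex x y = x * cnj y"
instance
  by standard
    (auto simp: scaleC_complex_def cinner_complex_def inner_complex_def scaleR_conv_of_real
      algebra_simps)
end

definition positive_op :: "('h::complex_hilbert_space \<Rightarrow> 'h) \<Rightarrow> bool" where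
  "positive_op A \<longleftrightarrow>
     bounded_linear A \<and> (\<forall>c x. A (scaleC c x) = scaleC c (A x)) \<and>
     (\<forall>x. cinner (A x) x \<in> \<real>\<^sub>\<ge>\<^sub>0)"

definition sqrt_op :: "('h::complex_hilbert_space \<Rightarrow> 'h) \<Rightarrow> ('h \<Rightarrow> 'h)" where
  "sqrt_op A = (THE R. positive_op R \<and> R \<circ> R = A)"

definition parallel_sum ::
  "('h::complex_hilbert_space \<Rightarrow> 'h) \<Rightarrow> ('h \<Rightarrow> 'h) \<Rightarrow> ('h \<Rightarrow> 'h)" where
  "parallel_sum A B =
     (THE P. positive_op P \<and>
        (\<forall>x. cinner (P x) x =
           complex_of_real (INF y. Re (cinner (A (x - y)) (x - y) + cinner (B y) y))))"


section \<open>Inner product spaces with explicit carrier\<close>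

text \<open>
  The completion attached to an operator depends on that operator, so it cannot be a type of the
  class above; it is a structure with an explicit carrier.
\<close>

record 'a ips =
  carrier :: "'a set"
  vadd :: "'a \<Rightarrow> 'a \<Rightarrow> 'a"
  vscale :: "complex \<Rightarrow> 'a \<Rightarrow> 'a"
  ip :: "'a \<Rightarrow> 'a \<Rightarrow> complex"

definition vdiff :: "'a ips \<Rightarrow> 'a \<Rightarrow> 'a \<Rightarrow> 'a" where
  "vdiff V x y = vadd V x (vscale V (-1) y)"

definition vnorm :: "'a ips \<Rightarrow> 'a \<Rightarrow> real" where
  "vnorm V x = sqrt (Re (ip V x x))"

definition whole :: "'h::complex_hilbert_space ips" where
  "whole = \<lparr>carrier = UNIV, vadd = (+), vscale = scaleC, ip = cinner\<rparr>"

text \<open>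
  Bounded linear operators between such spaces. They are required to be \<^const>\<open>undefined\<close> off the
  carrier of the domain, so that equality of operators is equality of functions.
\<close>

definition bounded_op :: "'a ips \<Rightarrow> 'b ips \<Rightarrow> ('a \<Rightarrow> 'b) \<Rightarrow> bool" where
  "bounded_op V W T \<longleftrightarrow>
     T \<in> carrier V \<rightarrow>\<^sub>E carrier W \<and>
     (\<forall>x\<in>carrier V. \<forall>y\<in>carrier V. T (vadd V x y) = vadd W (T x) (T y)) \<and>
     (\<forall>c. \<forall>x\<in>carrier V. T (vscale V c x) = vscale W c (T x)) \<and>
     (\<exists>M. \<forall>x\<in>carrier V. vnorm W (T x) \<le> M * vnorm V x)"

definition adjoint_op :: "'a ips \<Rightarrow> 'b ips \<Rightarrow> ('a \<Rightarrow> 'b) \<Rightarrow> ('b \<Rightarrow> 'a)" where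
  "adjoint_op V W T =
     (THE S. bounded_op W V S \<and>
        (\<forall>x\<in>carrier V. \<forall>y\<in>carrier W. ip W (T x) y = ip V x (S y)))"

definition id_minus :: "'a ips \<Rightarrow> ('a \<Rightarrow> 'a) \<Rightarrow> ('a \<Rightarrow> 'a)" where
  "id_minus V T = (\<lambda>x\<in>carrier V. vdiff V x (T x))"


section \<open>Completion by Cauchy sequences\<close>

definition cauchy_seqs :: "'a ips \<Rightarrow> (nat \<Rightarrow> 'a) set" where
  "cauchy_seqs V =
     {s. (\<forall>n. s n \<in> carrier V) \<and>
         (\<forall>e>0. \<exists>N. \<forall>m\<ge>N. \<forall>n\<ge>N. vnorm V (vdiff V (s m) (s n)) < e)}"

definition cauchy_rel :: "'a ips \<Rightarrow> ((nat \<Rightarrow> 'a) \<times> (nat \<Rightarrow> 'a)) set" where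
  "cauchy_rel V =
     {(s, t). s \<in> cauchy_seqs V \<and> t \<in> cauchy_seqs V \<and>
        (\<lambda>n. vnorm V (vdiff V (s n) (t n))) \<longlonglongrightarrow> 0}"

definition completion :: "'a ips \<Rightarrow> (nat \<Rightarrow> 'a) set ips" where
  "completion V =
     \<lparr>carrier = cauchy_seqs V // cauchy_rel V,
      vadd = (\<lambda>X Y. \<Union>s\<in>X. \<Union>t\<in>Y. cauchy_rel V `` {\<lambda>n. vadd V (s n) (t n)}),
      vscale = (\<lambda>c X. \<Union>s\<in>X. cauchy_rel V `` {\<lambda>n. vscale V c (s n)}),
      ip = (\<lambda>X Y. THE z. \<exists>s\<in>X. \<exists>t\<in>Y. (\<lambda>n. ip V (s n) (t n)) \<longlonglongrightarrow> z)\<rparr>"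

definition completion_embed :: "'a ips \<Rightarrow> 'a \<Rightarrow> (nat \<Rightarrow> 'a) set" where
  "completion_embed V x = cauchy_rel V `` {\<lambda>n. x}"


section \<open>The space \<open>H\<^sub>C\<close> and the associated operators\<close>

text \<open>\<open>ran C\<close> with the inner product \<open>(Cx | Cy)\<^sub>C = (Cx | y)\<close>.\<close>

definition ran_ips :: "('h::complex_hilbert_space \<Rightarrow> 'h) \<Rightarrow> 'h ips" where
  "ran_ips C =
     \<lparr>carrier = range C, vadd = (+), vscale = scaleC,
      ip = (\<lambda>u v. THE z. \<exists>x y. u = C x \<and> v = C y \<and> z = cinner (C x) y)\<rparr>"

definition op_space :: "('h::complex_hilbert_space \<Rightarrow> 'h) \<Rightarrow> (nat \<Rightarrow> 'h) set ips" where
  "op_space C = completion (ran_ips C)"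

text \<open>
  \<open>extend_op C f\<close> is the bounded operator from \<open>H\<^sub>C\<close> to \<open>H\<close> determined by \<open>C x \<mapsto> f x\<close> on the dense
  subspace \<open>ran C\<close>.
\<close>

definition extend_op ::
  "('h::complex_hilbert_space \<Rightarrow> 'h) \<Rightarrow> ('h \<Rightarrow> 'h) \<Rightarrow> ((nat \<Rightarrow> 'h) set \<Rightarrow> 'h)" where
  "extend_op C f =
     (THE T. bounded_op (op_space C) whole T \<and>
        (\<forall>x. T (completion_embed (ran_ips C) (C x)) = f x))"

definition J_op :: "('h::complex_hilbert_space \<Rightarrow> 'h) \<Rightarrow> ((nat \<Rightarrow> 'h) set \<Rightarrow> 'h)" where
  "J_op C = extend_op C C"

definition S_op ::
  "('h::complex_hilbert_space \<Rightarrow> 'h) \<Rightarrow> ('h \<Rightarrow> 'h) \<Rightarrow> ((nat \<Rightarrow> 'h) set \<Rightarrow> 'h)" where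
  "S_op C A = extend_op C (sqrt_op A)"

definition J_adj :: "('h::complex_hilbert_space \<Rightarrow> 'h) \<Rightarrow> ('h \<Rightarrow> (nat \<Rightarrow> 'h) set)" where
  "J_adj C = adjoint_op (op_space C) whole (J_op C)"

definition hat_op ::
  "('h::complex_hilbert_space \<Rightarrow> 'h) \<Rightarrow> ('h \<Rightarrow> 'h) \<Rightarrow>
     ((nat \<Rightarrow> 'h) set \<Rightarrow> (nat \<Rightarrow> 'h) set)" where
  "hat_op C A =
     compose (carrier (op_space C)) (adjoint_op (op_space C) whole (S_op C A)) (S_op C A)"

end

theory Submission
  imports Defs
begin

text \<open>
  With \<open>C = A + B\<close>, the map \<open>C x \<mapsto> C\<^sup>1\<^sup>/\<^sup>2 x\<close> identifies \<open>H\<^sub>C\<close> with the closure \<open>K\<close> of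
  \<open>ran C\<^sup>1\<^sup>/\<^sup>2\<close> in \<open>H\<close>, so every operator involved can be computed on \<open>H\<close> itself. Put
  \<open>Q = C\<^sup>1\<^sup>/\<^sup>2\<close> and \<open>R = A\<^sup>1\<^sup>/\<^sup>2\<close>. As \<open>A \<le> C\<close>, Douglas factorization gives \<open>D\<close> with \<open>D Q = R\<close>
  and an adjoint \<open>E\<close> with range in \<open>K\<close>, and then \<open>J\<^sub>C\<close>, \<open>S\<^sub>A\<close>, \<open>S\<^sub>A\<^sup>*\<close> become \<open>Q\<close>, \<open>D\<close>, \<open>E\<close>.
  Since \<open>Q E = R\<close>, the right-hand side is \<open>P = A - R D E R\<close>, and completing the square gives
  \<open>(A(x - y) | x - y) + (B y | y) = (P x | x) + \<parallel>Q y - E R x\<parallel>\<^sup>2\<close>. The last term has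
  infimum \<open>0\<close> over \<open>y\<close> because \<open>E R x\<close> lies in the closure of \<open>ran Q\<close>.
\<close>

section \<open>Real Hilbert spaces\<close>

lemma linear_coeff_eq_0:
  fixes a b :: real
  assumes nonneg: "\<And>t. 0 \<le> 2 * t * a + t\<^sup>2 * b"
  shows "a = 0"
proof (rule ccontr)
  assume "a \<noteq> 0"
  \<comment> \<open>The summand 1 keeps \<open>c\<close> positive when \<open>b = 0\<close> and
    makes \<open>b / c < 1\<close>; at \<open>t = - a / c\<close> the expression equals
    \<open>- (a\<^sup>2 / c) * (2 - b / c)\<close>, which is negative.\<close>
  define c where "c = \<bar>b\<bar> + 1"
  have c: "c > 0" "b < c" by (auto simp: c_def)
  have "2 * (- a / c) * a + (- a / c)\<^sup>2 * b = - (a\<^sup>2 / c) * (2 - b / c)"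
    using c by (simp add: field_simps power2_eq_square)
  moreover have "a\<^sup>2 / c > 0" using \<open>a \<noteq> 0\<close> c by simp
  moreover have "2 - b / c > 0" using c by (simp add: field_simps)
  ultimately have "2 * (- a / c) * a + (- a / c)\<^sup>2 * b < 0"
    using mult_pos_pos[of "a\<^sup>2 / c" "2 - b / c"] by linarith
  with nonneg[of "- a / c"] show False by simp
qed

text \<open>Up to a constant, the functional \<open>\<phi>\<close> below is the squared distance
  from \<open>Q y\<close> to the desired \<open>k\<close>. A minimizing sequence need not converge
  in the domain, but its images under \<open>Q\<close> do, by the parallelogram law, and their limit
  is \<open>k\<close>.\<close>

lemma riesz_dense_range:
  fixes Q :: "'a::real_normed_vector \<Rightarrow> 'b::{real_inner, complete_space}"
  assumes Q: "linear Q" and f: "linear f" and le: "\<And>y. f y \<le> M * norm (Q y)"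
  shows "\<exists>k\<in>closure (range Q). \<forall>y. f y = inner (Q y) k"
proof -
  interpret Q: linear Q by fact
  interpret f: linear f by fact
  define \<phi> where "\<phi> y = (norm (Q y))\<^sup>2 - 2 * f y" for y
  \<comment> \<open>The hypothesis gives
    \<open>\<phi> y \<ge> (norm (Q y) - M)\<^sup>2 - M\<^sup>2\<close>.\<close>
  have "\<phi> y \<ge> - M\<^sup>2" for y
    using le[of y] zero_le_power2[of "norm (Q y) - M"]
    by (simp add: \<phi>_def power2_eq_square algebra_simps)
  then have bdd: "bdd_below (range \<phi>)" by (intro bdd_belowI[of _ "- M\<^sup>2"]) auto
  define m where "m = Inf (range \<phi>)"
  have m_le: "m \<le> \<phi> y" for y
    unfolding m_def by (rule cInf_lower[OF _ bdd]) simp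
  have "\<exists>y. \<phi> y < m + 1 / real (Suc n)" for n
    using cInf_lessD[of "range \<phi>" "m + 1 / real (Suc n)"] by (auto simp: m_def)
  then obtain y where y: "\<And>n. \<phi> (y n) < m + 1 / real (Suc n)" by metis
  have \<phi>_lim: "(\<lambda>n. \<phi> (y n)) \<longlonglongrightarrow> m"
  proof (rule tendsto_sandwich[of "\<lambda>_. m"])
    show "(\<lambda>n. m + 1 / real (Suc n)) \<longlonglongrightarrow> m"
      using tendsto_add[OF tendsto_const[of m] LIMSEQ_Suc[OF lim_1_over_n[where 'a=real]]]
      by simp
  qed (use m_le y in \<open>auto intro: always_eventually less_imp_le\<close>)
  \<comment> \<open>The value of \<open>\<phi>\<close> at the midpoint is at least \<open>m\<close>,
    which bounds \<open>norm (Q u + Q v)\<close> from below; the parallelogram law turns this into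
    an upper bound for the difference.\<close>
  have par: "(norm (Q u - Q v))\<^sup>2 \<le> 2 * (\<phi> u - m) + 2 * (\<phi> v - m)" for u v
  proof -
    have "Q ((1/2) *\<^sub>R (u + v)) = (1/2) *\<^sub>R (Q u + Q v)" 
      "f ((1/2) *\<^sub>R (u + v)) = (f u + f v) / 2"
      by (simp_all add: Q.scaleR Q.add f.scaleR f.add add_divide_distrib scaleR_add_right)
    then have "\<phi> ((1/2) *\<^sub>R (u + v)) = (norm (Q u + Q v))\<^sup>2 / 4 - (f u + f v)"
      by (simp only: \<phi>_def norm_scaleR power_mult_distrib) (simp add: power_divide field_simps)
    then have "4 * m \<le> (norm (Q u + Q v))\<^sup>2 - 4 * (f u + f v)"
      using m_le[of "(1/2) *\<^sub>R (u + v)"] by simp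
    moreover have "(norm (Q u + Q v))\<^sup>2 + (norm (Q u - Q v))\<^sup>2 =
        2 * (norm (Q u))\<^sup>2 + 2 * (norm (Q v))\<^sup>2"
      by (simp add: power2_norm_eq_inner algebra_simps)
    ultimately show ?thesis by (simp add: \<phi>_def)
  qed
  have "Cauchy (\<lambda>n. Q (y n))"
  proof (rule metric_CauchyI)
    fix e :: real assume "e > 0"
    then have "e\<^sup>2 / 8 > 0" by simp
    then obtain N where N: "\<And>n. n \<ge> N \<Longrightarrow> \<bar>\<phi> (y n) - m\<bar> < e\<^sup>2 / 8"
      using LIMSEQ_D[OF \<phi>_lim] by (metis real_norm_def)
    have "dist (Q (y i)) (Q (y j)) < e" if "i \<ge> N" "j \<ge> N" for i j
    proof -
      have "(norm (Q (y i) - Q (y j)))\<^sup>2 < e\<^sup>2"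
        using par[of "y i" "y j"] N[OF that(1)] N[OF that(2)] \<open>e\<^sup>2 / 8 > 0\<close>
        unfolding abs_less_iff by simp
      then show ?thesis
        using \<open>e > 0\<close> by (simp add: dist_norm power2_less_imp_less)
    qed
    then show "\<exists>N. \<forall>i\<ge>N. \<forall>j\<ge>N. dist (Q (y i)) (Q (y j)) < e" by blast
  qed
  then obtain k where k: "(\<lambda>n. Q (y n)) \<longlonglongrightarrow> k"
    using Cauchy_convergent unfolding convergent_def by blast
  have "f z = inner (Q z) k" for z
  proof -
    \<comment> \<open>First variation: \<open>\<phi>\<close> is at least \<open>m\<close> at
      \<open>y n + t *\<^sub>R z\<close>, and letting \<open>n\<close> grow replaces
      \<open>\<phi> (y n)\<close> by \<open>m\<close> and \<open>Q (y n)\<close> by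
      \<open>k\<close>.\<close>
    have "0 \<le> 2 * t * (inner k (Q z) - f z) + t\<^sup>2 * (norm (Q z))\<^sup>2" for t
    proof -
      have eq: "\<phi> (y n + t *\<^sub>R z) =
          \<phi> (y n) + 2 * t * (inner (Q (y n)) (Q z) - f z) + t\<^sup>2 * (norm (Q z))\<^sup>2" for n
        by (simp add: \<phi>_def Q.scaleR Q.add f.scaleR f.add power2_norm_eq_inner algebra_simps
            inner_commute power2_eq_square[of t])
      then have "m \<le> \<phi> (y n) + 2 * t * (inner (Q (y n)) (Q z) - f z) + t\<^sup>2 * (norm (Q z))\<^sup>2" for n
        using m_le[of "y n + t *\<^sub>R z"] by (simp only: eq)
      moreover have "(\<lambda>n. \<phi> (y n) + 2 * t * (inner (Q (y n)) (Q z) - f z) + t\<^sup>2 * (norm (Q z))\<^sup>2)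
          \<longlonglongrightarrow> m + 2 * t * (inner k (Q z) - f z) + t\<^sup>2 * (norm (Q z))\<^sup>2"
        by (intro tendsto_intros \<phi>_lim k)
      ultimately have "m \<le> m + 2 * t * (inner k (Q z) - f z) + t\<^sup>2 * (norm (Q z))\<^sup>2"
        by (intro LIMSEQ_le_const) auto
      then show ?thesis by simp
    qed
    from linear_coeff_eq_0[OF this] show ?thesis by (simp add: inner_commute)
  qed
  moreover have "k \<in> closure (range Q)"
    unfolding closure_sequential by (intro exI[of _ "\<lambda>n. Q (y n)"]) (simp add: k)
  ultimately show ?thesis by (intro bexI[of _ k]) auto
qed

lemma subspace_closure:
  fixes S :: "'a::real_normed_vector set"
  assumes "subspace S"
  shows "subspace (closure S)"
proof (rule subspaceI)
  show "0 \<in> closure S"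
    using subspace_0[OF assms] closure_subset by blast
next
  fix x y assume "x \<in> closure S" "y \<in> closure S"
  then obtain s t where "\<And>n. s n \<in> S" "s \<longlonglongrightarrow> x" "\<And>n. t n \<in> S" "t \<longlonglongrightarrow> y"
    unfolding closure_sequential by blast
  then show "x + y \<in> closure S"
    unfolding closure_sequential
    by (intro exI[of _ "\<lambda>n. s n + t n"]) (auto intro: tendsto_add subspace_add[OF assms])
next
  fix c x assume "x \<in> closure S"
  then obtain s where "\<And>n. s n \<in> S" "s \<longlonglongrightarrow> x"
    unfolding closure_sequential by blast
  then show "c *\<^sub>R x \<in> closure S"
    unfolding closure_sequential
    by (intro exI[of _ "\<lambda>n. c *\<^sub>R s n"]) (auto intro: tendsto_intros subspace_scale[OF assms])
qed

lemma orthogonal_closure_eq_0: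
  fixes k :: "'a::real_inner"
  assumes "k \<in> closure S" and orth: "\<And>s. s \<in> S \<Longrightarrow> inner s k = 0"
  shows "k = 0"
proof -
  obtain s where s: "\<And>n. s n \<in> S" "s \<longlonglongrightarrow> k"
    using assms(1) unfolding closure_sequential by blast
  have "(\<lambda>n. inner (s n) k) \<longlonglongrightarrow> inner k k" by (intro tendsto_intros s)
  moreover have "(\<lambda>n. inner (s n) k) = (\<lambda>n. 0)" using orth s(1) by auto
  ultimately show ?thesis by (simp add: LIMSEQ_const_iff)
qed

lemma closure_range_diff:
  fixes Q :: "'a::real_normed_vector \<Rightarrow> 'b::real_normed_vector"
  assumes "linear Q" "u \<in> closure (range Q)" "v \<in> closure (range Q)"
  shows "u - v \<in> closure (range Q)"
proof -
  have "subspace (closure (range Q))"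
    using linear_subspace_image[OF assms(1) subspace_UNIV] by (rule subspace_closure)
  with assms(2,3) show ?thesis by (simp add: subspace_diff)
qed

text \<open>The difference of \<open>u\<close> and \<open>v\<close> lies in the closure and is
  orthogonal to the range, hence to itself. This uniqueness yields linearity of maps defined by
  Riesz representation.\<close>

lemma closure_range_inner_eqI:
  fixes Q :: "'a::real_normed_vector \<Rightarrow> 'b::real_inner"
  assumes "linear Q" "u \<in> closure (range Q)" "v \<in> closure (range Q)"
    and "\<And>y. inner (Q y) u = inner (Q y) v"
  shows "u = v"
proof -
  have "u - v = 0"
    by (rule orthogonal_closure_eq_0[OF closure_range_diff[OF assms(1-3)]])
      (auto simp: inner_diff_right assms(4))
  then show ?thesis by simp
qed

text \<open>\<open>E\<close> is the adjoint of the map sending \<open>Q y\<close> to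
  \<open>R y\<close>, obtained directly from Riesz representation instead of by first extending that
  map. \<open>E h\<close> represents the functional \<open>inner (R y) h\<close> of
  \<open>y\<close>.\<close>

lemma relative_adjoint:
  fixes Q :: "'a::real_normed_vector \<Rightarrow> 'b::{real_inner, complete_space}"
    and R :: "'a \<Rightarrow> 'c::real_inner"
  assumes Q: "linear Q" and R: "linear R" and M: "0 \<le> M"
    and le: "\<And>y. norm (R y) \<le> M * norm (Q y)"
  obtains E where "bounded_linear E" "\<And>h. E h \<in> closure (range Q)"
    "\<And>y h. inner (R y) h = inner (Q y) (E h)"
proof -
  have "\<exists>k\<in>closure (range Q). \<forall>y. inner (R y) h = inner (Q y) k" for h
  proof (rule riesz_dense_range[OF Q])
    show "linear (\<lambda>y. inner (R y) h)"
      using R by (simp add: linear_iff inner_add_left)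
    show "inner (R y) h \<le> norm h * M * norm (Q y)" for y
      using norm_cauchy_schwarz[of "R y" h] mult_right_mono[OF le[of y], of "norm h"]
      by (simp add: ac_simps)
  qed
  then obtain E where E: "\<And>h. E h \<in> closure (range Q)"
    "\<And>y h. inner (R y) h = inner (Q y) (E h)" by metis
  have sub: "subspace (closure (range Q))"
    using linear_subspace_image[OF Q subspace_UNIV] by (rule subspace_closure)
  have "linear E"
  proof (rule linearI)
    show "E (x + y) = E x + E y" for x y
      by (rule closure_range_inner_eqI[OF Q])
        (auto simp: E(1) subspace_add[OF sub] E(2)[symmetric] inner_add_right)
    show "E (r *\<^sub>R x) = r *\<^sub>R E x" for r x
      by (rule closure_range_inner_eqI[OF Q])
        (auto simp: E(1) subspace_scale[OF sub] E(2)[symmetric])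
  qed
  \<comment> \<open>Approximating \<open>E h\<close> by vectors \<open>Q (y n)\<close> and using
    that \<open>inner (Q (y n)) (E h)\<close> equals \<open>inner (R (y n)) h\<close> bounds the
    square of \<open>norm (E h)\<close> by \<open>norm h * M * norm (E h)\<close>.\<close>
  moreover have "norm (E h) \<le> norm h * M" for h
  proof -
    obtain s where s: "\<And>n. s n \<in> range Q" "s \<longlonglongrightarrow> E h"
      using E(1)[of h] unfolding closure_sequential by blast
    have "\<exists>y. s n = Q y" for n using s(1)[of n] by blast
    then obtain y where y: "\<And>n. s n = Q (y n)" by metis
    have "inner (E h) (E h) \<le> norm h * M * norm (E h)"
    proof (rule LIMSEQ_le)
      show "(\<lambda>n. inner (s n) (E h)) \<longlonglongrightarrow> inner (E h) (E h)" by (intro tendsto_intros s)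
      show "(\<lambda>n. norm h * M * norm (s n)) \<longlonglongrightarrow> norm h * M * norm (E h)"
        by (intro tendsto_intros s)
      have "inner (s n) (E h) \<le> norm h * M * norm (s n)" for n
        using norm_cauchy_schwarz[of "R (y n)" h] mult_right_mono[OF le[of "y n"], of "norm h"]
        by (simp add: y E(2)[symmetric] ac_simps)
      then show "\<exists>N. \<forall>n\<ge>N. inner (s n) (E h) \<le> norm h * M * norm (s n)" by blast
    qed
    moreover have "0 \<le> norm h * M" using M by simp
    ultimately show ?thesis
      by (cases "E h = 0") (auto simp: power2_norm_eq_inner[symmetric] power2_eq_square)
  qed
  ultimately have "bounded_linear E"
    by (auto simp: bounded_linear_def bounded_linear_axioms_def)
  with E show thesis using that by blast
qed

text \<open>\<open>D\<close> is the ordinary adjoint of the relative adjoint \<open>E\<close>, so it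
  is defined on the whole space and not only on the range of \<open>Q\<close>.\<close>

lemma douglas_factorization:
  fixes Q :: "'a::real_normed_vector \<Rightarrow> 'b::{real_inner, complete_space}"
    and R :: "'a \<Rightarrow> 'c::{real_inner, complete_space}"
  assumes "linear Q" "linear R" "0 \<le> M" "\<And>y. norm (R y) \<le> M * norm (Q y)"
  obtains D E where "bounded_linear D" "bounded_linear E" "\<And>y. D (Q y) = R y"
    "\<And>k h. inner (D k) h = inner k (E h)" "\<And>h. E h \<in> closure (range Q)"
proof -
  obtain E where E: "bounded_linear E" "\<And>h. E h \<in> closure (range Q)"
    "\<And>y h. inner (R y) h = inner (Q y) (E h)"
    using relative_adjoint[OF assms] by blast
  obtain K where K: "0 \<le> K" "\<And>h. norm (E h) \<le> K * norm h"
    using bounded_linear.nonneg_bounded[OF E(1)] by (auto simp: ac_simps)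
  \<comment> \<open>With the identity in the role of \<open>Q\<close>, the relative adjoint is the
    usual Hilbert space adjoint.\<close>
  obtain D where D: "bounded_linear D" "\<And>h k. inner (E h) k = inner h (D k)"
    by (rule relative_adjoint[OF linear_ident bounded_linear.linear[OF E(1)] K]) blast
  have "inner h (D (Q y)) = inner h (R y)" for h y
    using D(2)[of h "Q y"] E(3)[of y h] by (simp add: inner_commute)
  then have "D (Q y) = R y" for y
    by (metis vector_eq_ldot)
  moreover have "inner (D k) h = inner k (E h)" for k h
    using D(2)[of h k] by (simp add: inner_commute)
  ultimately show thesis using that D(1) E(1,2) by blast
qed

section \<open>Existence and uniqueness of square roots of positive operators\<close>

text \<open>At \<open>x + t *\<^sub>R z\<close> the form has no constant term, so its nonnegativity
  for all \<open>t\<close> kills the linear coefficient \<open>inner (A x) z\<close>, for every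
  \<open>z\<close>.\<close>

lemma nonneg_form_eq_0D:
  fixes A :: "'a::real_inner \<Rightarrow> 'a"
  assumes "linear A" and sym: "\<And>x y. inner (A x) y = inner x (A y)"
    and nonneg: "\<And>x. 0 \<le> inner (A x) x" and zero: "inner (A x) x = 0"
  shows "A x = 0"
proof -
  interpret A: linear A by fact
  have "inner (A x) z = 0" for z
  proof (rule linear_coeff_eq_0)
    show "0 \<le> 2 * t * inner (A x) z + t\<^sup>2 * inner (A z) z" for t
      using nonneg[of "x + t *\<^sub>R z"] zero sym[of z x]
      by (simp add: A.add A.scaleR algebra_simps inner_commute power2_eq_square)
  qed
  then show ?thesis using inner_eq_zero_iff by blast
qed

lemma form_eq_0D:
  fixes A :: "'a::real_inner \<Rightarrow> 'a"
  assumes "linear A" and sym: "\<And>x y. inner (A x) y = inner x (A y)"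
    and zero: "\<And>x. inner (A x) x = 0"
  shows "A x = 0"
  by (rule nonneg_form_eq_0D[OF assms(1,2)]) (auto simp: zero)

text \<open>
  With \<open>B = I - A\<close>, the square root of \<open>A\<close> is \<open>I - Y\<close> where \<open>2 Y = B + Y\<^sup>2\<close>; the scalar sequence
  \<open>sqrt_majorant\<close> solves the same recursion with \<open>B\<close> replaced by \<open>1\<close> and dominates the
  increments of the operator iterates.
\<close>

fun sqrt_iter :: "('a::real_vector \<Rightarrow> 'a) \<Rightarrow> nat \<Rightarrow> 'a \<Rightarrow> 'a" where
  "sqrt_iter B 0 x = 0"
| "sqrt_iter B (Suc n) x = (1/2) *\<^sub>R (B x + sqrt_iter B n (sqrt_iter B n x))"

fun sqrt_majorant :: "nat \<Rightarrow> real" where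
  "sqrt_majorant 0 = 0"
| "sqrt_majorant (Suc n) = (1 + (sqrt_majorant n)\<^sup>2) / 2"

declare sqrt_iter.simps(2) [simp del] sqrt_majorant.simps(2) [simp del]

lemma sqrt_majorant_bounds: "0 \<le> sqrt_majorant n \<and> sqrt_majorant n \<le> 1"
  by (induction n) (auto simp: sqrt_majorant.simps(2) power_le_one)

lemma sqrt_majorant_Cauchy: "Cauchy sqrt_majorant"
proof -
  \<comment> \<open>The increment is half of \<open>(1 - sqrt_majorant n)\<^sup>2\<close>.\<close>
  have "sqrt_majorant n \<le> sqrt_majorant (Suc n)" for n
    using zero_le_power2[of "1 - sqrt_majorant n"]
    by (simp add: sqrt_majorant.simps(2) power2_eq_square algebra_simps)
  then have "incseq sqrt_majorant" by (rule incseq_SucI)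
  then show ?thesis
    using sqrt_majorant_bounds by (metis incseq_convergent LIMSEQ_imp_Cauchy)
qed

context
  fixes B :: "'a::{real_inner, complete_space} \<Rightarrow> 'a"
  assumes B: "linear B" and le: "\<And>x. norm (B x) \<le> norm x"
    and sym: "\<And>x y. inner (B x) y = inner x (B y)"
begin

lemma sqrt_iter_linear: "linear (sqrt_iter B n)"
proof (induction n)
  case 0
  then show ?case by (simp add: linear_iff)
next
  case (Suc n)
  then show ?case using B
    by (simp add: linear_iff sqrt_iter.simps(2) algebra_simps)
qed

lemma sqrt_iter_symmetric: "inner (sqrt_iter B n x) y = inner x (sqrt_iter B n y)"
  by (induction n arbitrary: x y) (auto simp: sqrt_iter.simps(2) sym inner_add_left inner_add_right)

text \<open>The iterates are polynomials in \<open>B\<close>.\<close>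

lemma sqrt_iter_commute:
  assumes "linear T" "\<And>x. T (B x) = B (T x)"
  shows "T (sqrt_iter B n x) = sqrt_iter B n (T x)"
  by (induction n arbitrary: x)
    (auto simp: sqrt_iter.simps(2) assms(2) linear_add[OF assms(1)] linear_scale[OF assms(1)] linear_0[OF assms(1)])

lemma sqrt_iter_norm: "norm (sqrt_iter B n x) \<le> sqrt_majorant n * norm x"
proof (induction n arbitrary: x)
  case (Suc n)
  have "norm (sqrt_iter B n (sqrt_iter B n x)) \<le> sqrt_majorant n * (sqrt_majorant n * norm x)"
    using Suc[of "sqrt_iter B n x"] mult_left_mono[OF Suc[of x], of "sqrt_majorant n"]
      sqrt_majorant_bounds[of n] by linarith
  then have "norm (B x + sqrt_iter B n (sqrt_iter B n x)) \<le> (1 + (sqrt_majorant n)\<^sup>2) * norm x"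
    using norm_triangle_ineq[of "B x" "sqrt_iter B n (sqrt_iter B n x)"] le[of x]
    by (simp add: power2_eq_square algebra_simps)
  then show ?case
    by (simp only: sqrt_iter.simps(2) sqrt_majorant.simps(2) norm_scaleR)
qed simp

lemma sqrt_iter_step:
  "norm (sqrt_iter B (Suc n) x - sqrt_iter B n x) \<le>
    (sqrt_majorant (Suc n) - sqrt_majorant n) * norm x"
proof (induction n arbitrary: x)
  case 0
  then show ?case using le[of x] by (simp add: sqrt_iter.simps(2) sqrt_majorant.simps(2))
next
  case (Suc n)
  let ?Y = "sqrt_iter B" and ?y = "sqrt_majorant"
  interpret Y: linear "?Y (Suc n)" by (rule sqrt_iter_linear)
  define d where "d = ?Y (Suc n) x - ?Y n x"
  \<comment> \<open>The difference of squares is split as \<open>Y'(Y' - Y) + (Y' - Y)Y\<close>,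
    with \<open>Y\<close> and \<open>Y'\<close> consecutive iterates. The induction hypothesis is
    used at \<open>x\<close> for the first term and at \<open>?Y n x\<close> for the second; the two
    bounds recombine into the difference of squares of the majorants.\<close>
  have "?Y (Suc n) (?Y (Suc n) x) - ?Y n (?Y n x) =
      ?Y (Suc n) d + (?Y (Suc n) (?Y n x) - ?Y n (?Y n x))"
    by (simp add: d_def Y.diff)
  moreover have "norm (?Y (Suc n) d) \<le> ?y (Suc n) * ((?y (Suc n) - ?y n) * norm x)"
    using sqrt_iter_norm[of "Suc n" d] mult_left_mono[OF Suc[of x], of "?y (Suc n)"]
      sqrt_majorant_bounds[of "Suc n"] unfolding d_def by linarith
  moreover have "norm (?Y (Suc n) (?Y n x) - ?Y n (?Y n x)) \<le>
      (?y (Suc n) - ?y n) * (?y n * norm x)"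
  proof -
    have "0 \<le> ?y (Suc n) - ?y n"
      using zero_le_power2[of "1 - ?y n"]
      by (simp add: sqrt_majorant.simps(2) power2_eq_square algebra_simps)
    from mult_left_mono[OF sqrt_iter_norm[of n x] this] Suc[of "?Y n x"]
    show ?thesis by linarith
  qed
  ultimately have "norm (?Y (Suc n) (?Y (Suc n) x) - ?Y n (?Y n x)) \<le>
      ?y (Suc n) * ((?y (Suc n) - ?y n) * norm x) + (?y (Suc n) - ?y n) * (?y n * norm x)"
    using norm_triangle_ineq[of "?Y (Suc n) d" "?Y (Suc n) (?Y n x) - ?Y n (?Y n x)"] by (simp only:)
  also have "\<dots> = ((?y (Suc n))\<^sup>2 - (?y n)\<^sup>2) * norm x"
    by (simp add: power2_eq_square algebra_simps)
  finally have sq: "norm (?Y (Suc n) (?Y (Suc n) x) - ?Y n (?Y n x)) \<le>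
    ((?y (Suc n))\<^sup>2 - (?y n)\<^sup>2) * norm x" .
  have "?Y (Suc (Suc n)) x - ?Y (Suc n) x =
      (1/2) *\<^sub>R (?Y (Suc n) (?Y (Suc n) x) - ?Y n (?Y n x))"
    by (simp add: sqrt_iter.simps(2)[of B "Suc n"] sqrt_iter.simps(2)[of B n x]
        scaleR_right_diff_distrib scaleR_add_right)
  then have eq1: "norm (?Y (Suc (Suc n)) x - ?Y (Suc n) x) =
      norm (?Y (Suc n) (?Y (Suc n) x) - ?Y n (?Y n x)) / 2"
    by simp
  have eq2: "?y (Suc (Suc n)) - ?y (Suc n) = ((?y (Suc n))\<^sup>2 - (?y n)\<^sup>2) / 2"
    by (simp add: sqrt_majorant.simps(2)[of "Suc n"] sqrt_majorant.simps(2)[of n]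
        diff_divide_distrib add_divide_distrib)
  show ?case unfolding eq1 eq2 using sq by simp
qed

lemma sqrt_iter_diff:
  "norm (sqrt_iter B (m + n) x - sqrt_iter B n x) \<le>
    (sqrt_majorant (m + n) - sqrt_majorant n) * norm x"
proof (induction m)
  case (Suc m)
  have "norm (sqrt_iter B (Suc (m + n)) x - sqrt_iter B n x) \<le>
      norm (sqrt_iter B (Suc (m + n)) x - sqrt_iter B (m + n) x) +
      norm (sqrt_iter B (m + n) x - sqrt_iter B n x)"
    using norm_triangle_ineq[of "sqrt_iter B (Suc (m + n)) x - sqrt_iter B (m + n) x"
      "sqrt_iter B (m + n) x - sqrt_iter B n x"] by simp
  also have "\<dots> \<le> (sqrt_majorant (Suc (m + n)) - sqrt_majorant (m + n)) * norm x +
      (sqrt_majorant (m + n) - sqrt_majorant n) * norm x"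
    by (intro add_mono sqrt_iter_step Suc)
  finally show ?case by (simp add: algebra_simps)
qed simp

lemma sqrt_iter_Cauchy: "Cauchy (\<lambda>n. sqrt_iter B n x)"
proof (rule CauchyI')
  fix e :: real assume "e > 0"
  \<comment> \<open>Adding 1 covers the case \<open>x = 0\<close>.\<close>
  then have "e / (norm x + 1) > 0" by (simp add: add_nonneg_pos)
  then obtain N where N: "\<And>m n. m \<ge> N \<Longrightarrow> n \<ge> N \<Longrightarrow>
      \<bar>sqrt_majorant m - sqrt_majorant n\<bar> < e / (norm x + 1)"
    using CauchyD[OF sqrt_majorant_Cauchy] by (metis real_norm_def)
  have "norm (sqrt_iter B m x - sqrt_iter B n x) < e" if "n \<ge> N" and "n < m" for m n
  proof -
    obtain k where k: "m = k + n" using \<open>n < m\<close> by (metis less_imp_add_positive add.commute)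
    have d: "sqrt_majorant m - sqrt_majorant n < e / (norm x + 1)"
      using N[of m n] that by simp
    have "norm (sqrt_iter B m x - sqrt_iter B n x) \<le> (sqrt_majorant m - sqrt_majorant n) * norm x"
      unfolding k by (rule sqrt_iter_diff)
    also have "\<dots> \<le> e / (norm x + 1) * norm x"
      using d by (intro mult_right_mono) auto
    also have "\<dots> < e"
      using \<open>e > 0\<close> by (simp add: pos_divide_less_eq add_nonneg_pos)
    finally show ?thesis .
  qed
  then show "\<exists>M. \<forall>m\<ge>M. \<forall>n>m. dist (sqrt_iter B m x) (sqrt_iter B n x) < e"
    by (metis dist_norm dist_commute)
qed

text \<open>\<open>Y\<close> is the pointwise limit of the iterates. The last clause, inherited from
  the iterates by continuity of \<open>T\<close>, is what later gives uniqueness and complex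
  linearity of the square root.\<close>

lemma quadratic_fixed_point:
  obtains Y where "linear Y" "\<And>x. norm (Y x) \<le> norm x" "\<And>x y. inner (Y x) y = inner x (Y y)"
    "\<And>x. 2 *\<^sub>R Y x = B x + Y (Y x)"
    "\<And>T x. bounded_linear T \<Longrightarrow> (\<And>x. T (B x) = B (T x)) \<Longrightarrow> T (Y x) = Y (T x)"
proof -
  define Y where "Y x = lim (\<lambda>n. sqrt_iter B n x)" for x
  have Y: "(\<lambda>n. sqrt_iter B n x) \<longlonglongrightarrow> Y x" for x
    unfolding Y_def using Cauchy_convergent[OF sqrt_iter_Cauchy] by (rule convergent_LIMSEQ_iff[THEN iffD1])
  have lin: "linear Y"
  proof (rule linearI)
    show "Y (x + y) = Y x + Y y" for x y
      using LIMSEQ_unique[OF Y[of "x + y"]] tendsto_add[OF Y[of x] Y[of y]]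
      by (simp add: linear_add[OF sqrt_iter_linear])
    show "Y (c *\<^sub>R x) = c *\<^sub>R Y x" for c x
      using LIMSEQ_unique[OF Y[of "c *\<^sub>R x"]] tendsto_scaleR[OF tendsto_const[of c] Y[of x]]
      by (simp add: linear_scale[OF sqrt_iter_linear])
  qed
  have iter_le: "norm (sqrt_iter B n x) \<le> norm x" for n x
    using sqrt_iter_norm[of n x] mult_right_mono[of "sqrt_majorant n" 1 "norm x"]
      sqrt_majorant_bounds[of n] by simp
  have norm_le: "norm (Y x) \<le> norm x" for x
    by (rule LIMSEQ_le_const2[OF tendsto_norm[OF Y]]) (use iter_le in blast)
  have sym: "inner (Y x) y = inner x (Y y)" for x y
  proof -
    have "(\<lambda>n. inner (sqrt_iter B n x) y) \<longlonglongrightarrow> inner (Y x) y"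
      "(\<lambda>n. inner x (sqrt_iter B n y)) \<longlonglongrightarrow> inner x (Y y)"
      by (intro tendsto_intros Y)+
    then show ?thesis by (simp add: sqrt_iter_symmetric LIMSEQ_unique)
  qed
  \<comment> \<open>Pointwise convergence passes to the squares because the iterates are uniformly
    contractive: the \<open>n\<close>-th iterate of \<open>sqrt_iter B n x - Y x\<close> tends to 0,
    and that of \<open>Y x\<close> tends to \<open>Y (Y x)\<close>.\<close>
  have sq: "(\<lambda>n. sqrt_iter B n (sqrt_iter B n x)) \<longlonglongrightarrow> Y (Y x)" for x
  proof -
    have "(\<lambda>n. sqrt_iter B n (sqrt_iter B n x - Y x)) \<longlonglongrightarrow> 0"
    proof (rule Lim_null_comparison)
      show "(\<lambda>n. norm (sqrt_iter B n x - Y x)) \<longlonglongrightarrow> 0"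
        using tendsto_norm[OF tendsto_diff[OF Y[of x] tendsto_const[of "Y x"]]] by simp
    qed (simp add: iter_le)
    from tendsto_add[OF this Y[of "Y x"]] show ?thesis
      by (simp add: linear_diff[OF sqrt_iter_linear])
  qed
  have fixed: "2 *\<^sub>R Y x = B x + Y (Y x)" for x
  proof -
    have "(\<lambda>n. (1/2) *\<^sub>R (B x + sqrt_iter B n (sqrt_iter B n x))) \<longlonglongrightarrow> (1/2) *\<^sub>R (B x + Y (Y x))"
      by (intro tendsto_intros sq)
    moreover have "(\<lambda>n. (1/2) *\<^sub>R (B x + sqrt_iter B n (sqrt_iter B n x))) \<longlonglongrightarrow> Y x"
      using LIMSEQ_Suc[OF Y[of x]] by (simp add: sqrt_iter.simps(2))
    ultimately have "Y x = (1/2) *\<^sub>R (B x + Y (Y x))" using LIMSEQ_unique by blast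
    then have "2 *\<^sub>R Y x = 2 *\<^sub>R ((1/2) *\<^sub>R (B x + Y (Y x)))" by simp
    then show ?thesis by simp
  qed
  have comm: "T (Y x) = Y (T x)" if T: "bounded_linear T" "\<And>x. T (B x) = B (T x)" for T x
  proof -
    have "(\<lambda>n. T (sqrt_iter B n x)) \<longlonglongrightarrow> T (Y x)"
      by (rule bounded_linear.tendsto[OF T(1) Y])
    moreover have "(\<lambda>n. T (sqrt_iter B n x)) \<longlonglongrightarrow> Y (T x)"
      using Y[of "T x"] by (simp add: sqrt_iter_commute[OF bounded_linear.linear[OF T(1)] T(2)])
    ultimately show ?thesis using LIMSEQ_unique by blast
  qed
  show thesis by (rule that[of Y]) (use lin norm_le sym fixed comm in auto)
qed

end

lemma sqrt_exists_contraction: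
  fixes A :: "'a::{real_inner, complete_space} \<Rightarrow> 'a"
  assumes A: "linear A" and le: "\<And>x. norm (A x) \<le> norm x"
    and sym: "\<And>x y. inner (A x) y = inner x (A y)" and nonneg: "\<And>x. 0 \<le> inner (A x) x"
  obtains R where "bounded_linear R" "\<And>x y. inner (R x) y = inner x (R y)"
    "\<And>x. 0 \<le> inner (R x) x" "\<And>x. R (R x) = A x"
    "\<And>T x. bounded_linear T \<Longrightarrow> (\<And>x. T (A x) = A (T x)) \<Longrightarrow> T (R x) = R (T x)"
proof -
  interpret A: linear A by fact
  define B where "B x = x - A x" for x
  have linB: "linear B"
    by (rule linearI) (auto simp: B_def A.add A.scaleR algebra_simps)
  \<comment> \<open>Positivity at \<open>x - A x\<close> together with contractivity gives
    \<open>(norm (A x))\<^sup>2 \<le> inner (A x) x\<close>; expanding the square of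
    \<open>norm (x - A x)\<close> then bounds it by that of \<open>norm x\<close>.\<close>
  have normB: "norm (B x) \<le> norm x" for x
  proof -
    have "inner (A (A x)) (A x) \<le> (norm (A x))\<^sup>2"
      using norm_cauchy_schwarz[of "A (A x)" "A x"] mult_right_mono[OF le[of "A x"], of "norm (A x)"]
      by (simp add: power2_eq_square)
    moreover have "inner (A (A x)) x = (norm (A x))\<^sup>2"
      by (simp add: sym power2_norm_eq_inner)
    ultimately have "(norm (A x))\<^sup>2 \<le> inner (A x) x"
      using nonneg[of "x - A x"]
      by (simp add: A.diff inner_diff_left inner_diff_right power2_norm_eq_inner)
    then have "(norm (B x))\<^sup>2 \<le> (norm x)\<^sup>2"
      using nonneg[of x]
      by (simp add: B_def power2_norm_eq_inner inner_diff_left inner_diff_right inner_commute)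
    then show ?thesis by (rule power2_le_imp_le) simp
  qed
  have symB: "inner (B x) y = inner x (B y)" for x y
    by (simp add: B_def inner_diff_left inner_diff_right sym)
  obtain Y where Y: "linear Y" "\<And>x. norm (Y x) \<le> norm x" "\<And>x y. inner (Y x) y = inner x (Y y)"
    "\<And>x. 2 *\<^sub>R Y x = B x + Y (Y x)"
    "\<And>T x. bounded_linear T \<Longrightarrow> (\<And>x. T (B x) = B (T x)) \<Longrightarrow> T (Y x) = Y (T x)"
    using quadratic_fixed_point[OF linB normB symB] by blast
  interpret Y: linear Y by fact
  define R where "R x = x - Y x" for x
  have "bounded_linear R"
  proof (rule bounded_linear_intro)
    show "norm (R x) \<le> norm x * 2" for x
      using norm_triangle_ineq4[of x "Y x"] Y(2)[of x] by (simp add: R_def)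
  qed (auto simp: R_def Y.add Y.scaleR algebra_simps)
  moreover have "inner (R x) y = inner x (R y)" for x y
    by (simp add: R_def inner_diff_left inner_diff_right Y(3))
  moreover have "0 \<le> inner (R x) x" for x
    using norm_cauchy_schwarz[of "Y x" x] mult_right_mono[OF Y(2)[of x], of "norm x"]
    by (simp add: R_def inner_diff_left power2_norm_eq_inner[symmetric] power2_eq_square)
  moreover have "R (R x) = A x" for x
    using Y(4)[of x] by (simp add: R_def Y.diff B_def scaleR_2 algebra_simps)
  moreover have "T (R x) = R (T x)"
    if T: "bounded_linear T" "\<And>x. T (A x) = A (T x)" for T x
  proof -
    interpret T: bounded_linear T by fact
    have "T (B x) = B (T x)" for x by (simp add: B_def T.diff T(2))
    then show ?thesis using Y(5)[OF T(1)] by (simp add: R_def T.diff)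
  qed
  ultimately show thesis by (rule that)
qed

text \<open>Dividing by a norm bound \<open>M\<close> reduces to a contraction; its root is
  multiplied by \<open>sqrt M\<close> afterwards.\<close>

lemma sqrt_exists:
  fixes A :: "'a::{real_inner, complete_space} \<Rightarrow> 'a"
  assumes A: "bounded_linear A"
    and sym: "\<And>x y. inner (A x) y = inner x (A y)" and nonneg: "\<And>x. 0 \<le> inner (A x) x"
  obtains R where "bounded_linear R" "\<And>x y. inner (R x) y = inner x (R y)"
    "\<And>x. 0 \<le> inner (R x) x" "\<And>x. R (R x) = A x"
    "\<And>T x. bounded_linear T \<Longrightarrow> (\<And>x. T (A x) = A (T x)) \<Longrightarrow> T (R x) = R (T x)"
proof -
  interpret A: bounded_linear A by fact
  obtain M where M: "M > 0" "\<And>x. norm (A x) \<le> norm x * M" using A.pos_bounded by blast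
  obtain R where R: "bounded_linear R" "\<And>x y. inner (R x) y = inner x (R y)"
    "\<And>x. 0 \<le> inner (R x) x" "\<And>x. R (R x) = (1 / M) *\<^sub>R A x"
    "\<And>T x. bounded_linear T \<Longrightarrow> (\<And>x. T ((1 / M) *\<^sub>R A x) = (1 / M) *\<^sub>R A (T x)) \<Longrightarrow> T (R x) = R (T x)"
  proof (rule sqrt_exists_contraction[of "\<lambda>x. (1 / M) *\<^sub>R A x"])
    show "linear (\<lambda>x. (1 / M) *\<^sub>R A x)"
      by (rule linearI) (auto simp: A.add A.scaleR algebra_simps)
    show "norm ((1 / M) *\<^sub>R A x) \<le> norm x" for x
      using M by (simp add: field_simps)
    show "0 \<le> inner ((1 / M) *\<^sub>R A x) x" for x
      using M(1) nonneg[of x] by simp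
  qed (use sym in auto)
  interpret R: bounded_linear R by fact
  define S where "S x = sqrt M *\<^sub>R R x" for x
  have "bounded_linear S"
    unfolding S_def by (intro bounded_linear_intros R(1))
  moreover have "inner (S x) y = inner x (S y)" for x y by (simp add: S_def R(2))
  moreover have "0 \<le> inner (S x) x" for x using M(1) R(3)[of x] by (simp add: S_def)
  moreover have "S (S x) = A x" for x using M(1) by (simp add: S_def R.scaleR R(4))
  moreover have "T (S x) = S (T x)"
    if T: "bounded_linear T" "\<And>x. T (A x) = A (T x)" for T x
    using R(5)[OF T(1)] by (simp add: S_def linear_scale[OF bounded_linear.linear[OF T(1)]] T(2))
  ultimately show thesis by (rule that)
qed

text \<open>For \<open>y = R x - S x\<close>, commutation gives
  \<open>R y + S y = R (R x) - S (S x) = 0\<close>. Both nonnegative forms therefore vanish at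
  \<open>y\<close>, so \<open>R y = S y = 0\<close>, and moving \<open>R\<close> and
  \<open>S\<close> across the inner product makes \<open>inner y y\<close> vanish.\<close>

lemma sqrt_unique:
  fixes R S :: "'a::real_inner \<Rightarrow> 'a"
  assumes R: "linear R" "\<And>x y. inner (R x) y = inner x (R y)" "\<And>x. 0 \<le> inner (R x) x"
    and S: "linear S" "\<And>x y. inner (S x) y = inner x (S y)" "\<And>x. 0 \<le> inner (S x) x"
    and eq: "\<And>x. R (R x) = S (S x)" and comm: "\<And>x. R (S x) = S (R x)"
  shows "R x = S x"
proof -
  interpret R: linear R by fact
  interpret S: linear S by fact
  define y where "y = R x - S x"
  have "inner (R y + S y) y = 0"
    by (simp add: y_def R.diff S.diff eq comm)
  then have "inner (R y) y = 0" "inner (S y) y = 0"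
    using R(3)[of y] S(3)[of y] by (auto simp: inner_add_left)
  then have "R y = 0" "S y = 0"
    using nonneg_form_eq_0D[OF R] nonneg_form_eq_0D[OF S] by auto
  then have "inner y y = 0"
    using R(2)[of x y] S(2)[of x y] by (simp add: y_def inner_diff_left)
  then show ?thesis by (simp add: y_def)
qed

section \<open>Complex operators\<close>

lemma cinner_scaleC_right:
  "cinner x (scaleC c y) = cnj c * cinner (x :: 'h::complex_hilbert_space) y"
  by (metis cinner_commute cinner_scaleC_left complex_cnj_mult)

lemma inner_scaleC_left:
  "inner (scaleC c x) y = inner x (scaleC (cnj c) (y :: 'h::complex_hilbert_space))"
  by (simp add: inner_eq_Re_cinner cinner_scaleC_left cinner_scaleC_right)

lemma cinner_eq_Complex_inner:
  "cinner x y = Complex (inner x y) (inner x (scaleC \<i> (y :: 'h::complex_hilbert_space)))"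
  by (simp add: inner_eq_Re_cinner cinner_scaleC_right complex_eq_iff)

lemma cinner_eq_norm: "cinner x x = complex_of_real ((norm (x :: 'h::complex_hilbert_space))\<^sup>2)"
proof -
  have "Im (cinner x x) = 0"
    using arg_cong[OF cinner_commute[of x x], of Im] by simp
  then show ?thesis
    by (simp add: complex_eq_iff power2_norm_eq_inner inner_eq_Re_cinner)
qed

lemma norm_scaleC: "norm (scaleC c (x :: 'h::complex_hilbert_space)) = cmod c * norm x"
proof -
  have "complex_of_real ((norm (scaleC c x))\<^sup>2) = (c * cnj c) * complex_of_real ((norm x)\<^sup>2)"
    by (simp only: cinner_eq_norm[symmetric] cinner_scaleC_left cinner_scaleC_right) simp
  also have "\<dots> = complex_of_real ((cmod c * norm x)\<^sup>2)"
    by (simp add: complex_norm_square[symmetric] power_mult_distrib)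
  finally show ?thesis
    by (simp only: of_real_eq_iff power2_eq_iff_nonneg norm_ge_zero mult_nonneg_nonneg)
qed

lemma scaleC_scaleR: "scaleC c (r *\<^sub>R x) = r *\<^sub>R scaleC c (x :: 'h::complex_hilbert_space)"
  by (metis scaleC_of_real scaleC_scaleC mult.commute)

lemma bounded_linear_scaleC:
  "bounded_linear (scaleC c :: 'h::complex_hilbert_space \<Rightarrow> 'h)"
  by (rule bounded_linear_intro[where K = "cmod c"])
    (simp_all add: scaleC_add_right scaleC_scaleR norm_scaleC)

lemma scaleC_minus1: "scaleC (-1) x = - (x :: 'h::complex_hilbert_space)"
  using scaleC_of_real[of "-1" x] by simp

lemma tendsto_cinner:
  fixes f g :: "'b \<Rightarrow> 'h::complex_hilbert_space"
  assumes "(f \<longlongrightarrow> a) F" "(g \<longlongrightarrow> b) F"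
  shows "((\<lambda>n. cinner (f n) (g n)) \<longlongrightarrow> cinner a b) F"
  unfolding cinner_eq_Complex_inner
  using assms bounded_linear.tendsto[OF bounded_linear_scaleC assms(2)]
  by (intro tendsto_Complex tendsto_inner)

definition bounded_clinear :: "('h::complex_hilbert_space \<Rightarrow> 'k::complex_hilbert_space) \<Rightarrow> bool" where
  "bounded_clinear T \<longleftrightarrow> bounded_linear T \<and> (\<forall>c x. T (scaleC c x) = scaleC c (T x))"

lemma bounded_clinear_compose:
  "bounded_clinear S \<Longrightarrow> bounded_clinear T \<Longrightarrow> bounded_clinear (\<lambda>x. S (T x))"
  by (simp add: bounded_clinear_def bounded_linear_compose)

lemma bounded_clinear_diff:
  "bounded_clinear S \<Longrightarrow> bounded_clinear T \<Longrightarrow> bounded_clinear (\<lambda>x. S x - T x)"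
  by (auto simp: bounded_clinear_def bounded_linear_sub
      linear_diff[OF bounded_linear.linear[OF bounded_linear_scaleC]])

lemma bounded_clinear_add:
  "bounded_clinear S \<Longrightarrow> bounded_clinear T \<Longrightarrow> bounded_clinear (\<lambda>x. S x + T x)"
  by (simp add: bounded_clinear_def bounded_linear_add scaleC_add_right)

text \<open>Multiplication by \<open>c\<close> has multiplication by \<open>cnj c\<close> as its
  real adjoint, so complex linearity passes from \<open>E\<close> to \<open>D\<close>. The imaginary
  part of \<open>cinner\<close> is the real inner product with \<open>scaleC \<i> h\<close>, so the
  complex adjoint relation consists of two real ones.\<close>

lemma adjoint_bounded_clinear:
  assumes D: "bounded_linear D" and E: "bounded_clinear E"
    and adj: "\<And>k h. inner (D k) h = inner k (E h)"
  shows "bounded_clinear D" "cinner (D k) h = cinner k (E h)"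
proof -
  have "inner (D (scaleC c k)) h = inner (scaleC c (D k)) h" for c k h
    using E by (simp add: adj inner_scaleC_left bounded_clinear_def)
  then have "D (scaleC c k) = scaleC c (D k)" for c k
    by (metis vector_eq_rdot)
  with D show "bounded_clinear D" by (simp add: bounded_clinear_def)
  show "cinner (D k) h = cinner k (E h)"
    using E by (simp add: cinner_eq_Complex_inner adj bounded_clinear_def)
qed

text \<open>This makes the results on real Hilbert spaces applicable. That the form is real means
  that \<open>inner (A x) (scaleC \<i> x)\<close> vanishes identically, and polarization turns this
  into symmetry.\<close>

lemma positive_op_iff:
  "positive_op A \<longleftrightarrow> bounded_clinear A \<and> (\<forall>x y. inner (A x) y = inner x (A y)) \<and>
     (\<forall>x. 0 \<le> inner (A x) x)"
proof (cases "bounded_clinear A")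
  case True
  then have lin: "A (x + y) = A x + A y" and clin: "A (scaleC c x) = scaleC c (A x)" for c x y
    by (auto simp: bounded_clinear_def linear_add bounded_linear.linear)
  have form: "cinner (A x) x \<in> \<real>\<^sub>\<ge>\<^sub>0 \<longleftrightarrow> 0 \<le> inner (A x) x \<and> inner (A x) (scaleC \<i> x) = 0" for x
    by (simp add: complex_nonneg_Reals_iff cinner_eq_Complex_inner)
  have ii: "scaleC \<i> (scaleC \<i> x) = - x" "scaleC (- \<i>) (scaleC \<i> x) = x" for x :: 'a
    using scaleC_of_real[of 1 x] by (simp_all add: scaleC_scaleC scaleC_minus1)
  have "(\<forall>x. inner (A x) (scaleC \<i> x) = 0) \<longleftrightarrow> (\<forall>x y. inner (A x) y = inner x (A y))"
  proof (intro iffI allI)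
    fix x y assume zero: "\<forall>x. inner (A x) (scaleC \<i> x) = 0"
    \<comment> \<open>Polarization leaves only the mixed terms; the choice
      \<open>z = scaleC \<i> y\<close> then turns them into the two sides of the symmetry
      relation.\<close>
    have "inner (A (x + z)) (scaleC \<i> (x + z)) =
        inner (A x) (scaleC \<i> z) + inner (A z) (scaleC \<i> x)" for z
      using zero[rule_format, of x] zero[rule_format, of z]
      by (simp add: lin scaleC_add_right inner_add_left inner_add_right)
    then have "inner (A x) (scaleC \<i> z) + inner (A z) (scaleC \<i> x) = 0" for z
      using zero by metis
    from this[of "scaleC \<i> y"] show "inner (A x) y = inner x (A y)"
      by (simp add: clin ii inner_scaleC_left inner_commute)
  next
    fix x assume "\<forall>x y. inner (A x) y = inner x (A y)"
    then have "inner (A x) (scaleC \<i> x) = inner x (scaleC \<i> (A x))" by (simp add: clin)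
    also have "\<dots> = inner (scaleC (- \<i>) x) (A x)" by (simp add: inner_scaleC_left)
    also have "scaleC (- \<i>) x = - scaleC \<i> x"
      by (metis scaleC_minus1 scaleC_scaleC mult_minus1)
    finally show "inner (A x) (scaleC \<i> x) = 0" by (simp add: inner_commute)
  qed
  with True show ?thesis
    unfolding positive_op_def form by (auto simp: bounded_clinear_def)
qed (auto simp: positive_op_def bounded_clinear_def)

lemma positive_opD:
  assumes "positive_op A"
  shows "bounded_clinear A" "bounded_linear A" "linear A" "A (scaleC c x) = scaleC c (A x)"
    "inner (A x) y = inner x (A y)" "0 \<le> inner (A x) x" "cinner (A x) y = cinner x (A y)"
    "cinner (A x) x = complex_of_real (inner (A x) x)"
proof -
  show A: "bounded_clinear A" "inner (A x) y = inner x (A y)" "0 \<le> inner (A x) x" for x y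
    using assms unfolding positive_op_iff by blast+
  then show "bounded_linear A" "A (scaleC c x) = scaleC c (A x)"
    by (simp_all add: bounded_clinear_def)
  then show "linear A" "cinner (A x) y = cinner x (A y)"
    using adjoint_bounded_clinear(2)[OF _ A(1) A(2)] by (simp_all add: bounded_linear.linear)
  have "cinner (A x) x \<in> \<real>\<^sub>\<ge>\<^sub>0" using assms by (simp add: positive_op_def)
  then show "cinner (A x) x = complex_of_real (inner (A x) x)"
    by (simp add: complex_nonneg_Reals_iff complex_eq_iff inner_eq_Re_cinner)
qed

lemma positive_op_add:
  "positive_op A \<Longrightarrow> positive_op B \<Longrightarrow> positive_op (\<lambda>x. A x + B x)"
  unfolding positive_op_iff inner_add_left inner_add_right
  using bounded_clinear_add[of A B] by (metis add_nonneg_nonneg)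

lemma positive_op_eqI:
  assumes "positive_op P" "positive_op P'" "\<And>x. inner (P x) x = inner (P' x) x"
  shows "P = P'"
proof
  fix x
  note P = positive_opD[OF assms(1)] and P' = positive_opD[OF assms(2)]
  have "P x - P' x = 0"
    by (rule form_eq_0D[of "\<lambda>x. P x - P' x"])
      (simp_all add: linear_compose_sub P(3) P'(3) inner_diff_left inner_diff_right P(5) P'(5)
        assms(3)[simplified P(5) P'(5)])
  then show "P x = P' x" by simp
qed

text \<open>The real root \<open>R\<close> commutes with every bounded operator commuting with
  \<open>A\<close>. Applied to scalar multiplications this gives complex linearity; applied to
  another positive root \<open>S\<close>, which commutes with \<open>A = S \<circ> S\<close>, it
  permits the use of \<open>sqrt_unique\<close>.\<close>

lemma sqrt_op:
  fixes A :: "'h::complex_hilbert_space \<Rightarrow> 'h"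
  assumes "positive_op A"
  shows "positive_op (sqrt_op A)" "sqrt_op A (sqrt_op A x) = A x"
proof -
  note A = positive_opD[OF assms]
  obtain R where R: "bounded_linear R" "\<And>x y. inner (R x) y = inner x (R y)"
    "\<And>x. 0 \<le> inner (R x) x" "\<And>x. R (R x) = A x"
    "\<And>T x. bounded_linear T \<Longrightarrow> (\<And>x. T (A x) = A (T x)) \<Longrightarrow> T (R x) = R (T x)"
    using sqrt_exists[OF A(2) A(5) A(6)] by blast
  have "R (scaleC c x) = scaleC c (R x)" for c x
    by (rule R(5)[OF bounded_linear_scaleC, symmetric]) (simp add: A(4))
  then have "positive_op R"
    using R(1-3) by (simp add: positive_op_iff bounded_clinear_def)
  moreover have "S = R" if S: "positive_op S" "S \<circ> S = A" for S
  proof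
    fix x
    note S' = positive_opD[OF S(1)]
    have SS: "S (S x) = A x" for x using S(2) by (simp add: fun_eq_iff)
    have comm: "S (R x) = R (S x)" for x
      by (rule R(5)[OF S'(2)]) (simp add: SS[symmetric])
    show "S x = R x"
      by (rule sqrt_unique[OF S'(3) S'(5) S'(6) bounded_linear.linear[OF R(1)] R(2) R(3)])
        (simp_all add: SS R(4) comm)
  qed
  moreover have "R \<circ> R = A" using R(4) by (simp add: comp_def)
  ultimately have "\<exists>!R. positive_op R \<and> R \<circ> R = A" by blast
  from theI'[OF this] have sq: "positive_op (sqrt_op A)" "sqrt_op A \<circ> sqrt_op A = A"
    unfolding sqrt_op_def by blast+
  show "positive_op (sqrt_op A)" by (rule sq(1))
  show "sqrt_op A (sqrt_op A x) = A x" using fun_cong[OF sq(2), of x] by simp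
qed

lemma sqrt_op_norm:
  assumes "positive_op A"
  shows "(norm (sqrt_op A x))\<^sup>2 = inner (A x) x"
  using positive_opD(5)[OF sqrt_op(1)[OF assms], of "sqrt_op A x" x] sqrt_op(2)[OF assms, of x]
  by (simp add: power2_norm_eq_inner)

lemma closure_range_scaleC:
  assumes "bounded_clinear Q" "k \<in> closure (range Q)"
  shows "scaleC c k \<in> closure (range Q)"
proof -
  obtain s where s: "\<And>n. s n \<in> range Q" "s \<longlonglongrightarrow> k"
    using assms(2) unfolding closure_sequential by blast
  have "scaleC c (s n) \<in> range Q" for n
    using s(1)[of n] assms(1) by (auto simp: bounded_clinear_def) (metis rangeI)
  moreover have "(\<lambda>n. scaleC c (s n)) \<longlonglongrightarrow> scaleC c k"
    by (rule bounded_linear.tendsto[OF bounded_linear_scaleC s(2)])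
  ultimately show ?thesis
    unfolding closure_sequential by (intro exI[of _ "\<lambda>n. scaleC c (s n)"]) auto
qed

text \<open>Tested against \<open>Q y\<close>, the scalar \<open>c\<close> moves to \<open>y\<close>
  as its conjugate, passes through \<open>Q\<close> and \<open>R\<close>, and returns; uniqueness in
  the closure gives complex linearity of \<open>E\<close>, and that of \<open>D\<close> follows by
  adjunction.\<close>

lemma douglas_factorization_complex:
  assumes Q: "bounded_clinear Q" and R: "bounded_clinear R" and "0 \<le> M"
    and "\<And>y. norm (R y) \<le> M * norm (Q y)"
  obtains D E where "bounded_clinear D" "bounded_clinear E" "\<And>y. D (Q y) = R y"
    "\<And>k h. inner (D k) h = inner k (E h)" "\<And>h. E h \<in> closure (range Q)"
proof -
  have lin: "linear Q" "linear R"
    using Q R by (auto simp: bounded_clinear_def bounded_linear.linear)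
  obtain D E where DE: "bounded_linear D" "bounded_linear E" "\<And>y. D (Q y) = R y"
    "\<And>k h. inner (D k) h = inner k (E h)" "\<And>h. E h \<in> closure (range Q)"
    using douglas_factorization[OF lin assms(3,4)] by blast
  have QE: "inner (Q y) (E h) = inner (R y) h" for y h
    using DE(4)[of "Q y" h] DE(3)[of y] by simp
  have "E (scaleC c h) = scaleC c (E h)" for c h
  proof (rule closure_range_inner_eqI[OF lin(1)])
    fix y
    have "inner (Q y) (scaleC c (E h)) = inner (Q (scaleC (cnj c) y)) (E h)"
      using Q by (simp add: inner_scaleC_left bounded_clinear_def)
    also have "\<dots> = inner (Q y) (E (scaleC c h))"
      using R by (simp add: QE inner_scaleC_left bounded_clinear_def)
    finally show "inner (Q y) (E (scaleC c h)) = inner (Q y) (scaleC c (E h))" by simp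
  qed (simp_all add: DE(5) closure_range_scaleC[OF Q])
  then have "bounded_clinear E" using DE(2) by (simp add: bounded_clinear_def)
  moreover from this have "bounded_clinear D"
    using adjoint_bounded_clinear(1)[OF DE(1) _ DE(4)] by blast
  ultimately show thesis using that DE(3-5) by blast
qed

section \<open>Completions modelled inside a Hilbert space\<close>

lemma carrier_whole [simp]: "carrier whole = UNIV"
  and vadd_whole [simp]: "vadd whole = (+)"
  and vscale_whole [simp]: "vscale whole = scaleC"
  and ip_whole [simp]: "ip whole = cinner"
  by (simp_all add: whole_def)

lemma vnorm_whole [simp]: "vnorm whole x = norm x"
  by (simp add: vnorm_def cinner_eq_norm)

section \<open>Spaces with explicit carrier, parametrized by a subset of a Hilbert space\<close>

locale hilbert_model =
  fixes V :: "'a ips" and K :: "'h::complex_hilbert_space set" and \<Phi> :: "'h \<Rightarrow> 'a"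
  assumes add_closed: "h \<in> K \<Longrightarrow> k \<in> K \<Longrightarrow> h + k \<in> K"
    and scale_closed: "h \<in> K \<Longrightarrow> scaleC c h \<in> K"
    and carrier_eq: "carrier V = \<Phi> ` K"
    and vadd: "h \<in> K \<Longrightarrow> k \<in> K \<Longrightarrow> vadd V (\<Phi> h) (\<Phi> k) = \<Phi> (h + k)"
    and vscale: "h \<in> K \<Longrightarrow> vscale V c (\<Phi> h) = \<Phi> (scaleC c h)"
    and ip: "h \<in> K \<Longrightarrow> k \<in> K \<Longrightarrow> ip V (\<Phi> h) (\<Phi> k) = cinner h k"
begin

lemma diff_closed: "h \<in> K \<Longrightarrow> k \<in> K \<Longrightarrow> h - k \<in> K"
  using add_closed[of h "- k"] scale_closed[of k "-1"] by (simp add: scaleC_minus1)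

lemma vnorm: "h \<in> K \<Longrightarrow> vnorm V (\<Phi> h) = norm h"
  by (simp add: vnorm_def ip cinner_eq_norm)

lemma vdiff: "h \<in> K \<Longrightarrow> k \<in> K \<Longrightarrow> vdiff V (\<Phi> h) (\<Phi> k) = \<Phi> (h - k)"
  using scale_closed[of k "-1"] by (simp add: vdiff_def vadd vscale scaleC_minus1)

text \<open>If two parameters name the same vector, their difference has the same inner product with
  both, hence is orthogonal to itself.\<close>

lemma inj: "inj_on \<Phi> K"
proof (rule inj_onI)
  fix h k assume hk: "h \<in> K" "k \<in> K" "\<Phi> h = \<Phi> k"
  have "cinner (h - k) h = cinner (h - k) k"
    using hk ip[OF diff_closed[OF hk(1,2)]] by metis
  from arg_cong[OF this, of Re] have "inner (h - k) (h - k) = 0"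
    by (simp add: inner_eq_Re_cinner[symmetric] inner_diff_right)
  then show "h = k" by simp
qed

text \<open>The restriction of \<open>D\<close> to \<open>K\<close>, transported to
  \<open>V\<close>; the bounded abstraction supplies the value \<open>undefined\<close> off the
  carrier that \<open>bounded_op\<close> demands.\<close>

definition lift :: "('h \<Rightarrow> 'b) \<Rightarrow> 'a \<Rightarrow> 'b" where
  "lift D = (\<lambda>X\<in>carrier V. D (inv_into K \<Phi> X))"

lemma lift [simp]: "k \<in> K \<Longrightarrow> lift D (\<Phi> k) = D k"
  by (simp add: lift_def carrier_eq inj)

lemma lift_extensional: "lift D \<in> extensional (carrier V)"
  by (simp add: lift_def)

lemma bounded_op_lift:
  assumes "bounded_clinear D"
  shows "bounded_op V whole (lift D)"
proof -
  have D: "D (x + y) = D x + D y" "D (scaleC c x) = scaleC c (D x)" for x y c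
    using assms by (auto simp: bounded_clinear_def linear_add bounded_linear.linear)
  obtain M where "\<And>x. norm (D x) \<le> norm x * M"
    using assms bounded_linear.bounded[of D] unfolding bounded_clinear_def by blast
  then have "\<exists>M. \<forall>x\<in>carrier V. norm (lift D x) \<le> M * vnorm V x"
    by (intro exI[of _ M]) (auto simp: carrier_eq vnorm mult.commute)
  then show ?thesis
    unfolding bounded_op_def
    by (auto simp: PiE_def lift_extensional)
      (auto simp: carrier_eq vadd vscale add_closed scale_closed D)
qed

lemma bounded_op_into:
  assumes E: "bounded_clinear E" "\<And>h. E h \<in> K"
  shows "bounded_op whole V (\<lambda>h. \<Phi> (E h))"
proof -
  have "E (x + y) = E x + E y" "E (scaleC c x) = scaleC c (E x)" for x y c
    using E(1) by (auto simp: bounded_clinear_def linear_add bounded_linear.linear)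
  moreover obtain M where "\<And>x. norm (E x) \<le> norm x * M"
    using E(1) bounded_linear.bounded[of E] unfolding bounded_clinear_def by blast
  ultimately show ?thesis
    using E(2) by (auto simp: bounded_op_def carrier_eq vnorm vadd vscale mult.commute)
qed

lemma adjoint_op_lift:
  assumes E: "bounded_clinear E" "\<And>h. E h \<in> K"
    and adj: "\<And>k h. cinner (D k) h = cinner k (E h)"
  shows "adjoint_op V whole (lift D) = (\<lambda>h. \<Phi> (E h))"
  unfolding adjoint_op_def
proof (rule the_equality)
  show "bounded_op whole V (\<lambda>h. \<Phi> (E h)) \<and>
      (\<forall>x\<in>carrier V. \<forall>y\<in>carrier whole. ip whole (lift D x) y = ip V x (\<Phi> (E y)))"
    using bounded_op_into[OF E] by (auto simp: carrier_eq ip E(2) adj)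
next
  fix S
  assume S: "bounded_op whole V S \<and>
      (\<forall>x\<in>carrier V. \<forall>y\<in>carrier whole. ip whole (lift D x) y = ip V x (S y))"
  show "S = (\<lambda>h. \<Phi> (E h))"
  proof
    fix h
    have "S h \<in> carrier V" using S by (auto simp: bounded_op_def)
    then obtain k where k: "k \<in> K" "S h = \<Phi> k" by (auto simp: carrier_eq)
    \<comment> \<open>The discrepancy itself lies in \<open>K\<close>, so the adjoint relation may
      be tested on it.\<close>
    define j where "j = k - E h"
    have j: "j \<in> K" using k(1) E(2) by (simp add: j_def diff_closed)
    have "ip whole (lift D (\<Phi> j)) h = ip V (\<Phi> j) (S h)"
      using S j by (simp add: carrier_eq)
    then have "cinner j (E h) = cinner j k"
      using j k by (simp add: adj ip)
    from arg_cong[OF this, of Re] have "inner j j = 0"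
      by (simp add: inner_eq_Re_cinner[symmetric] j_def inner_diff_right)
    then show "S h = \<Phi> (E h)" by (simp add: j_def k(2))
  qed
qed

text \<open>Continuity on the dense set \<open>S\<close> determines the operator; this is the
  uniqueness behind the description in \<open>extend_op\<close>.\<close>

lemma bounded_op_eq_lift:
  assumes T: "bounded_op V whole T" and D: "bounded_clinear D"
    and S: "S \<subseteq> K" "K \<subseteq> closure S" and eq: "\<And>k. k \<in> S \<Longrightarrow> T (\<Phi> k) = D k"
  shows "T = lift D"
proof (rule extensionalityI[OF _ lift_extensional])
  show "T \<in> extensional (carrier V)" using T by (auto simp: bounded_op_def PiE_def)
next
  fix X assume "X \<in> carrier V"
  then obtain k where k: "k \<in> K" "X = \<Phi> k" by (auto simp: carrier_eq)
  have "\<exists>M. \<forall>X\<in>carrier V. norm (T X) \<le> M * vnorm V X"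
    using T by (simp add: bounded_op_def)
  then obtain M where M: "\<And>X. X \<in> carrier V \<Longrightarrow> norm (T X) \<le> M * vnorm V X"
    by blast
  have T_add: "T (vadd V (\<Phi> h) (\<Phi> j)) = T (\<Phi> h) + T (\<Phi> j)" if "h \<in> K" "j \<in> K" for h j
    using T that by (simp add: bounded_op_def carrier_eq)
  have T_diff: "T (\<Phi> (h - j)) = T (\<Phi> h) - T (\<Phi> j)" if "h \<in> K" "j \<in> K" for h j
    using T_add[OF diff_closed[OF that] that(2)] that by (simp add: vadd diff_closed)
  obtain s where s: "\<And>n. s n \<in> S" "s \<longlonglongrightarrow> k"
    using subsetD[OF S(2) k(1)] unfolding closure_sequential by blast
  have "(\<lambda>n. T (\<Phi> k) - T (\<Phi> (s n))) \<longlonglongrightarrow> 0"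
  proof (rule Lim_null_comparison)
    have "norm (T (\<Phi> k) - T (\<Phi> (s n))) \<le> M * norm (k - s n)" for n
    proof -
      have "s n \<in> K" using s(1) S(1) by blast
      then show ?thesis
        using M[of "\<Phi> (k - s n)"] k(1) by (simp add: T_diff carrier_eq vnorm diff_closed)
    qed
    then show "\<forall>\<^sub>F n in sequentially. norm (T (\<Phi> k) - T (\<Phi> (s n))) \<le> M * norm (k - s n)" by simp
    have "(\<lambda>n. M * norm (k - s n)) \<longlonglongrightarrow> M * norm (k - k)"
      by (intro tendsto_intros s(2))
    then show "(\<lambda>n. M * norm (k - s n)) \<longlonglongrightarrow> 0" by simp
  qed
  moreover have "(\<lambda>n. T (\<Phi> k) - T (\<Phi> (s n))) \<longlonglongrightarrow> T (\<Phi> k) - D k"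
    using D unfolding eq[OF s(1)] bounded_clinear_def
    by (intro tendsto_diff tendsto_const bounded_linear.tendsto[of D] s(2)) blast
  ultimately have "T (\<Phi> k) = D k" using LIMSEQ_unique by fastforce
  then show "T X = lift D X" using k by simp
qed

end

section \<open>The completion of a space mapped isometrically into a Hilbert space\<close>

locale ips_map =
  fixes V :: "'a ips" and g :: "'a \<Rightarrow> 'h::complex_hilbert_space"
  assumes vadd_closed: "x \<in> carrier V \<Longrightarrow> y \<in> carrier V \<Longrightarrow> vadd V x y \<in> carrier V"
    and vscale_closed: "x \<in> carrier V \<Longrightarrow> vscale V c x \<in> carrier V"
    and map_vadd: "x \<in> carrier V \<Longrightarrow> y \<in> carrier V \<Longrightarrow> g (vadd V x y) = g x + g y"
    and map_vscale: "x \<in> carrier V \<Longrightarrow> g (vscale V c x) = scaleC c (g x)"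
    and map_ip: "x \<in> carrier V \<Longrightarrow> y \<in> carrier V \<Longrightarrow> ip V x y = cinner (g x) (g y)"
begin

lemma vnorm_vdiff: "x \<in> carrier V \<Longrightarrow> y \<in> carrier V \<Longrightarrow> vnorm V (vdiff V x y) = norm (g x - g y)"
  by (simp add: vnorm_def vdiff_def vadd_closed vscale_closed map_ip map_vadd map_vscale
      scaleC_minus1 cinner_eq_norm)

lemma cauchy_seqs_eq: "cauchy_seqs V = {s. (\<forall>n. s n \<in> carrier V) \<and> Cauchy (\<lambda>n. g (s n))}"
  by (auto simp: cauchy_seqs_def Cauchy_def dist_norm vnorm_vdiff)

text \<open>For \<open>h\<close> in the closure of the image this is one point of the completion, as
  an equivalence class of Cauchy sequences; for other \<open>h\<close> it is empty.\<close>

definition fiber :: "'h \<Rightarrow> (nat \<Rightarrow> 'a) set" where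
  "fiber h = {s. (\<forall>n. s n \<in> carrier V) \<and> (\<lambda>n. g (s n)) \<longlonglongrightarrow> h}"

lemma fiber_subset: "fiber h \<subseteq> cauchy_seqs V"
  by (auto simp: fiber_def cauchy_seqs_eq LIMSEQ_imp_Cauchy)

text \<open>Since \<open>g\<close> preserves norms of differences, equivalence of two Cauchy
  sequences means that their images have the same limit.\<close>

lemma cauchy_rel_image:
  assumes "s \<in> fiber h"
  shows "cauchy_rel V `` {s} = fiber h"
proof -
  have s: "\<And>n. s n \<in> carrier V" "(\<lambda>n. g (s n)) \<longlonglongrightarrow> h" "s \<in> cauchy_seqs V"
    using assms fiber_subset[of h] by (auto simp: fiber_def)
  have "(s, t) \<in> cauchy_rel V \<longleftrightarrow> t \<in> fiber h" for t
  proof (cases "\<forall>n. t n \<in> carrier V")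
    case True
    have "(\<lambda>n. norm (g (s n) - g (t n))) \<longlonglongrightarrow> 0 \<longleftrightarrow> (\<lambda>n. g (t n)) \<longlonglongrightarrow> h"
    proof
      assume "(\<lambda>n. norm (g (s n) - g (t n))) \<longlonglongrightarrow> 0"
      then have "(\<lambda>n. g (s n) - (g (s n) - g (t n))) \<longlonglongrightarrow> h - 0"
        by (intro tendsto_diff s(2)) (simp add: tendsto_norm_zero_iff)
      then show "(\<lambda>n. g (t n)) \<longlonglongrightarrow> h" by simp
    next
      assume "(\<lambda>n. g (t n)) \<longlonglongrightarrow> h"
      from tendsto_norm[OF tendsto_diff[OF s(2) this]]
      show "(\<lambda>n. norm (g (s n) - g (t n))) \<longlonglongrightarrow> 0" by simp
    qed
    then show ?thesis
      using True s(1,3) fiber_subset[of h] by (auto simp: cauchy_rel_def vnorm_vdiff fiber_def)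
  qed (auto simp: cauchy_rel_def cauchy_seqs_def fiber_def)
  then show ?thesis by auto
qed

lemma fiber_nonempty:
  assumes "h \<in> closure (g ` carrier V)"
  obtains s where "s \<in> fiber h"
proof -
  obtain u where u: "\<And>n. u n \<in> g ` carrier V" "u \<longlonglongrightarrow> h"
    using assms unfolding closure_sequential by blast
  have "\<exists>x. x \<in> carrier V \<and> u n = g x" for n using u(1)[of n] by blast
  then obtain s where s: "\<And>n. s n \<in> carrier V \<and> u n = g (s n)" by metis
  then have "u = (\<lambda>n. g (s n))" by auto
  with u(2) s have "s \<in> fiber h" by (simp add: fiber_def)
  then show thesis by (rule that)
qed

lemma carrier_completion: "carrier (completion V) = fiber ` closure (g ` carrier V)"
proof
  show "carrier (completion V) \<subseteq> fiber ` closure (g ` carrier V)"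
  proof
    fix X assume "X \<in> carrier (completion V)"
    then obtain s where s: "s \<in> cauchy_seqs V" "X = cauchy_rel V `` {s}"
      by (auto simp: completion_def elim: quotientE)
    then have "Cauchy (\<lambda>n. g (s n))" by (simp add: cauchy_seqs_eq)
    then obtain h where h: "(\<lambda>n. g (s n)) \<longlonglongrightarrow> h"
      using Cauchy_convergent unfolding convergent_def by blast
    then have "s \<in> fiber h" using s(1) by (simp add: fiber_def cauchy_seqs_eq)
    then have "X = fiber h" by (simp add: s(2) cauchy_rel_image)
    moreover have "h \<in> closure (g ` carrier V)"
      unfolding closure_sequential using h s(1)
      by (intro exI[of _ "\<lambda>n. g (s n)"]) (auto simp: cauchy_seqs_eq)
    ultimately show "X \<in> fiber ` closure (g ` carrier V)" by blast
  qed
next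
  show "fiber ` closure (g ` carrier V) \<subseteq> carrier (completion V)"
  proof
    fix X assume "X \<in> fiber ` closure (g ` carrier V)"
    then obtain h where h: "h \<in> closure (g ` carrier V)" "X = fiber h" by blast
    then obtain s where s: "s \<in> fiber h" using fiber_nonempty by blast
    then have "X = cauchy_rel V `` {s}" by (simp add: h(2) cauchy_rel_image)
    then show "X \<in> carrier (completion V)"
      using s fiber_subset by (auto simp: completion_def intro: quotientI)
  qed
qed

lemma completion_embed: "x \<in> carrier V \<Longrightarrow> completion_embed V x = fiber (g x)"
  unfolding completion_embed_def by (rule cauchy_rel_image) (simp add: fiber_def)

lemma model_completion: "hilbert_model (completion V) (closure (g ` carrier V)) fiber"
proof
  fix h k c
  assume h: "h \<in> closure (g ` carrier V)"
  \<comment> \<open>All representatives contribute the same fiber to the unions defining the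
    operations; a representative must exist, as otherwise the union would be empty.\<close>
  obtain s0 where s0: "s0 \<in> fiber h" using fiber_nonempty[OF h] by blast
  have scale: "(\<lambda>n. vscale V c (s n)) \<in> fiber (scaleC c h)" if "s \<in> fiber h" for s
    using that by (auto simp: fiber_def vscale_closed map_vscale
        intro: bounded_linear.tendsto[OF bounded_linear_scaleC])
  have "(\<Union>s\<in>fiber h. cauchy_rel V `` {\<lambda>n. vscale V c (s n)}) = (\<Union>s\<in>fiber h. fiber (scaleC c h))"
    by (intro SUP_cong refl cauchy_rel_image scale)
  then show "vscale (completion V) c (fiber h) = fiber (scaleC c h)"
    using s0 by (auto simp: completion_def)
  show "scaleC c h \<in> closure (g ` carrier V)"
    unfolding closure_sequential using scale[OF s0]
    by (intro exI[of _ "\<lambda>n. g (vscale V c (s0 n))"]) (auto simp: fiber_def)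
  assume k: "k \<in> closure (g ` carrier V)"
  obtain t0 where t0: "t0 \<in> fiber k" using fiber_nonempty[OF k] by blast
  have add: "(\<lambda>n. vadd V (s n) (t n)) \<in> fiber (h + k)" if "s \<in> fiber h" "t \<in> fiber k" for s t
    using that by (auto simp: fiber_def vadd_closed map_vadd intro: tendsto_add)
  have "(\<Union>s\<in>fiber h. \<Union>t\<in>fiber k. cauchy_rel V `` {\<lambda>n. vadd V (s n) (t n)}) =
      (\<Union>s\<in>fiber h. \<Union>t\<in>fiber k. fiber (h + k))"
    by (intro SUP_cong refl cauchy_rel_image add)
  then show "vadd (completion V) (fiber h) (fiber k) = fiber (h + k)"
    using s0 t0 by (auto simp: completion_def)
  show "h + k \<in> closure (g ` carrier V)"
    unfolding closure_sequential using add[OF s0 t0]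
    by (intro exI[of _ "\<lambda>n. g (vadd V (s0 n) (t0 n))"]) (auto simp: fiber_def)
  have lim: "(\<lambda>n. ip V (s n) (t n)) \<longlonglongrightarrow> cinner h k" if "s \<in> fiber h" "t \<in> fiber k" for s t
    using that by (auto simp: fiber_def map_ip intro: tendsto_cinner)
  have "(THE z. \<exists>s\<in>fiber h. \<exists>t\<in>fiber k. (\<lambda>n. ip V (s n) (t n)) \<longlonglongrightarrow> z) = cinner h k"
  proof (rule the_equality)
    show "\<exists>s\<in>fiber h. \<exists>t\<in>fiber k. (\<lambda>n. ip V (s n) (t n)) \<longlonglongrightarrow> cinner h k"
      using lim s0 t0 by blast
  qed (use lim LIMSEQ_unique in blast)
  then show "ip (completion V) (fiber h) (fiber k) = cinner h k"
    by (simp add: completion_def)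
qed (rule carrier_completion)

end

section \<open>The parallel sum\<close>

definition form_map :: "('h::complex_hilbert_space \<Rightarrow> 'h) \<Rightarrow> 'h \<Rightarrow> 'h" where
  "form_map C u = sqrt_op C (SOME x. C x = u)"

text \<open>The choice of preimage is immaterial: if \<open>C z = 0\<close>, then the square of
  \<open>norm (sqrt_op C z)\<close>, being \<open>inner (C z) z\<close>, vanishes.\<close>

lemma form_map:
  assumes C: "positive_op C"
  shows "form_map C (C x) = sqrt_op C x"
proof -
  define y where "y = (SOME y. C y = C x)"
  have "C y = C x" unfolding y_def by (rule someI) simp
  then have "C (y - x) = 0"
    by (simp add: linear_diff[OF positive_opD(3)[OF C]])
  then have "sqrt_op C (y - x) = 0"
    using sqrt_op_norm[OF C, of "y - x"] by simp
  then show ?thesis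
    by (simp add: form_map_def y_def[symmetric] linear_diff[OF positive_opD(3)[OF sqrt_op(1)[OF C]]])
qed

lemma ips_map_ran_ips:
  assumes C: "positive_op C"
  shows "ips_map (ran_ips C) (form_map C)"
proof -
  let ?Q = "sqrt_op C"
  note C' = positive_opD[OF C] and Q' = positive_opD[OF sqrt_op(1)[OF C]]
  have add: "C x + C y = C (x + y)" "?Q (x + y) = ?Q x + ?Q y" for x y
    using C'(3) Q'(3) by (simp_all add: linear_add)
  have "ip (ran_ips C) (C x) (C y) = cinner (?Q x) (?Q y)" for x y
  proof -
    have form: "cinner (C x') y' = cinner (?Q x') (?Q y')" for x' y'
      by (simp add: Q'(7)[symmetric] sqrt_op(2)[OF C])
    \<comment> \<open>Every choice of preimages gives the same value, since the inner product is
      expressed through square roots, which depend only on \<open>C x\<close> and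
      \<open>C y\<close>.\<close>
    have "(THE z. \<exists>x' y'. C x = C x' \<and> C y = C y' \<and> z = cinner (C x') y') = cinner (?Q x) (?Q y)"
      by (rule the_equality) (auto simp: form, metis form_map[OF C])
    then show ?thesis by (simp add: ran_ips_def)
  qed
  then show ?thesis
    by unfold_locales (auto simp: ran_ips_def add C'(4)[symmetric] form_map[OF C] Q'(4))
qed

lemma op_space_model:
  assumes C: "positive_op C"
  obtains \<Phi> where "hilbert_model (op_space C) (closure (range (sqrt_op C))) \<Phi>"
    "\<And>x. completion_embed (ran_ips C) (C x) = \<Phi> (sqrt_op C x)"
proof -
  interpret ips_map "ran_ips C" "form_map C" by (rule ips_map_ran_ips[OF C])
  have carr: "carrier (ran_ips C) = range C" by (simp add: ran_ips_def)
  have "form_map C ` range C = range (sqrt_op C)"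
    by (auto simp: form_map[OF C] image_image)
  then have "hilbert_model (op_space C) (closure (range (sqrt_op C))) fiber"
    using model_completion by (simp add: op_space_def carr)
  moreover have "completion_embed (ran_ips C) (C x) = fiber (sqrt_op C x)" for x
    using completion_embed[of "C x"] by (simp add: carr form_map[OF C])
  ultimately show thesis by (rule that)
qed

section \<open>The parallel sum and its factorization\<close>

lemma parallel_sum_eqI:
  assumes P: "positive_op P"
    and form: "\<And>x. inner (P x) x =
      (INF y. Re (cinner (A (x - y)) (x - y) + cinner (B y) y))"
  shows "parallel_sum A B = P"
  unfolding parallel_sum_def
proof (rule the_equality)
  show "positive_op P \<and> (\<forall>x. cinner (P x) x =
      complex_of_real (INF y. Re (cinner (A (x - y)) (x - y) + cinner (B y) y)))"
    unfolding form[symmetric] using P positive_opD(8)[OF P] by blast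
next
  fix P' assume P': "positive_op P' \<and> (\<forall>x. cinner (P' x) x =
      complex_of_real (INF y. Re (cinner (A (x - y)) (x - y) + cinner (B y) y)))"
  then have "cinner (P' x) x = complex_of_real (inner (P x) x)" for x
    unfolding form by blast
  then have "inner (P' x) x = inner (P x) x" for x
    by (simp add: inner_eq_Re_cinner)
  then show "P' = P" using positive_op_eqI P P' by blast
qed

lemma parallel_sum_commute: "parallel_sum A B = parallel_sum B A"
proof -
  have "(INF y. Re (cinner (A (x - y)) (x - y) + cinner (B y) y)) =
      (INF y. Re (cinner (B (x - y)) (x - y) + cinner (A y) y))" for x
  proof -
    \<comment> \<open>Substituting \<open>x - y\<close> for \<open>y\<close> exchanges the two
      forms.\<close>
    have "range (\<lambda>y. x - y) = UNIV" by (metis surj_def diff_diff_eq2 add_diff_cancel_left')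
    then have "(\<lambda>y. Re (cinner (A (x - y)) (x - y) + cinner (B y) y)) ` UNIV =
        (\<lambda>y. Re (cinner (A (x - y)) (x - y) + cinner (B y) y)) ` range (\<lambda>y. x - y)" by simp
    also have "\<dots> = range (\<lambda>y. Re (cinner (B (x - y)) (x - y) + cinner (A y) y))"
      by (simp only: image_image) (simp add: add.commute)
    finally show ?thesis by simp
  qed
  then show ?thesis by (simp add: parallel_sum_def)
qed

lemma parallel_sum_factorization:
  assumes A: "positive_op A" and B: "positive_op B"
  defines "C \<equiv> \<lambda>x. A x + B x"
  shows "parallel_sum A B = J_op C \<circ> hat_op C A \<circ> id_minus (op_space C) (hat_op C A) \<circ> J_adj C"
proof -
  define Q where "Q = sqrt_op C"
  define R where "R = sqrt_op A"
  define K where "K = closure (range Q)"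
  have C: "positive_op C" unfolding C_def by (rule positive_op_add[OF A B])
  have Q_op: "positive_op Q" and QQ: "Q (Q x) = C x" and Q_norm: "(norm (Q x))\<^sup>2 = inner (C x) x" for x
    by (simp_all add: Q_def sqrt_op[OF C] sqrt_op_norm[OF C])
  have R_op: "positive_op R" and RR: "R (R x) = A x" and R_norm: "(norm (R x))\<^sup>2 = inner (A x) x" for x
    by (simp_all add: R_def sqrt_op[OF A] sqrt_op_norm[OF A])
  note Q' = positive_opD[OF Q_op] and R' = positive_opD[OF R_op]
    and A' = positive_opD[OF A] and B' = positive_opD[OF B]
  \<comment> \<open>Positivity of \<open>B\<close> gives \<open>A \<le> C\<close>, so the Douglas
    constant is 1.\<close>
  have le: "norm (R y) \<le> 1 * norm (Q y)" for y
  proof -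
    have "(norm (R y))\<^sup>2 \<le> (norm (Q y))\<^sup>2"
      using B'(6)[of y] by (simp add: R_norm Q_norm C_def inner_add_left)
    then show ?thesis by (simp add: power2_le_iff_abs_le)
  qed
  obtain D E where DE: "bounded_clinear D" "bounded_clinear E" "\<And>y. D (Q y) = R y"
    "\<And>k h. inner (D k) h = inner k (E h)" "\<And>h. E h \<in> K"
    by (rule douglas_factorization_complex[OF Q'(1) R'(1) zero_le_one le, folded K_def]) blast
  \<comment> \<open>The adjoint of \<open>D Q = R\<close>, as \<open>Q\<close> and \<open>R\<close>
    are symmetric.\<close>
  have QE: "Q (E h) = R h" for h
  proof -
    have "inner (Q (E h)) z = inner (R h) z" for z
      using DE(4)[of "Q z" h] Q'(5)[of "E h" z] R'(5)[of h z] by (simp add: DE(3) inner_commute)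
    then show ?thesis by (metis vector_eq_rdot)
  qed

  define P where "P x = A x - R (D (E (R x)))" for x
  have P_form: "inner (P x) y = inner (A x) y - inner (E (R x)) (E (R y))" for x y
    by (simp add: P_def inner_diff_left R'(5) DE(4))
  have P_inf: "inner (P x) x = (INF y. Re (cinner (A (x - y)) (x - y) + cinner (B y) y))" for x
  proof -
    \<comment> \<open>The cross term of the square is
      \<open>inner (D (Q y)) (R x) = inner (R y) (R x) = inner (A x) y\<close>, exactly the mixed
      term of the form of \<open>A\<close> at \<open>x - y\<close>.\<close>
    have eq: "Re (cinner (A (x - y)) (x - y) + cinner (B y) y) =
        inner (P x) x + (norm (Q y - E (R x)))\<^sup>2" for y
    proof -
      have "inner (Q y) (E (R x)) = inner (A x) y"
        using DE(4)[of "Q y" "R x"] R'(5)[of "R x" y] by (simp add: DE(3) RR inner_commute)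
      then have "(norm (Q y - E (R x)))\<^sup>2 =
          inner (C y) y - 2 * inner (A x) y + (norm (E (R x)))\<^sup>2"
        unfolding Q_norm[symmetric] by (simp add: power2_norm_eq_inner algebra_simps inner_commute)
      moreover have "inner (A y) x = inner (A x) y"
        by (metis A'(5) inner_commute)
      then have "inner (A (x - y)) (x - y) = inner (A x) x - 2 * inner (A x) y + inner (A y) y"
        by (simp add: linear_diff[OF A'(3)] inner_diff_left inner_diff_right)
      ultimately show ?thesis
        by (simp add: inner_eq_Re_cinner[symmetric] P_form C_def inner_add_left
            power2_norm_eq_inner)
    qed
    obtain s where s: "\<And>n. s n \<in> range Q" "s \<longlonglongrightarrow> E (R x)"
      using DE(5)[of "R x"] unfolding K_def closure_sequential by blast
    have "\<exists>y. s n = Q y" for n using s(1)[of n] by blast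
    then obtain y where y: "\<And>n. s n = Q (y n)" by metis
    have "(INF y. inner (P x) x + (norm (Q y - E (R x)))\<^sup>2) = inner (P x) x"
    proof (rule cInf_eq_non_empty)
      fix b assume b: "\<And>v. v \<in> range (\<lambda>y. inner (P x) x + (norm (Q y - E (R x)))\<^sup>2) \<Longrightarrow> b \<le> v"
      have "(\<lambda>n. inner (P x) x + (norm (s n - E (R x)))\<^sup>2) \<longlonglongrightarrow>
          inner (P x) x + (norm (E (R x) - E (R x)))\<^sup>2"
        by (intro tendsto_intros s(2))
      moreover have "b \<le> inner (P x) x + (norm (s n - E (R x)))\<^sup>2" for n
        unfolding y by (rule b) blast
      ultimately show "b \<le> inner (P x) x"
        using LIMSEQ_le_const[of _ "inner (P x) x" b] by simp
    qed auto
    then show ?thesis by (simp only: eq)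
  qed
  have "positive_op P"
    unfolding positive_op_iff
  proof (intro conjI allI)
    show "bounded_clinear P"
      unfolding P_def
      by (rule bounded_clinear_diff[OF A'(1) bounded_clinear_compose[OF R'(1)
            bounded_clinear_compose[OF DE(1) bounded_clinear_compose[OF DE(2) R'(1)]]]])
    show "inner (P x) y = inner x (P y)" for x y
    proof -
      have "inner (P x) y = inner (P y) x"
        using P_form[of x y] P_form[of y x] A'(5)[of y x] by (simp add: inner_commute)
      then show ?thesis by (simp add: inner_commute)
    qed
    \<comment> \<open>Positivity is read off from the variational formula, whose terms are all
      nonnegative.\<close>
    show "0 \<le> inner (P x) x" for x
      unfolding P_inf
      by (rule cINF_greatest) (simp_all add: inner_eq_Re_cinner[symmetric] A'(6) B'(6))
  qed
  then have P: "parallel_sum A B = P" using P_inf by (rule parallel_sum_eqI)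

  obtain \<Phi> where "hilbert_model (op_space C) K \<Phi>"
    and embed: "\<And>x. completion_embed (ran_ips C) (C x) = \<Phi> (Q x)"
    using op_space_model[OF C] unfolding K_def Q_def by blast
  then interpret hilbert_model "op_space C" K \<Phi> by simp
  have Q_K: "Q x \<in> K" for x unfolding K_def by (rule subsetD[OF closure_subset]) simp
  \<comment> \<open>The model sends the class of \<open>C x\<close> to \<open>Q x\<close>, so the
    operator determined by \<open>f\<close> is any bounded \<open>F\<close> with
    \<open>F (Q x) = f x\<close>: \<open>Q\<close> for \<open>J_op C\<close>, and \<open>D\<close>
    for \<open>S_op C A\<close>.\<close>
  have extend: "extend_op C f = lift F" if F: "bounded_clinear F" "\<And>x. F (Q x) = f x" for f F
    unfolding extend_op_def
  proof (rule the_equality)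
    show "bounded_op (op_space C) whole (lift F) \<and>
        (\<forall>x. lift F (completion_embed (ran_ips C) (C x)) = f x)"
      by (simp add: bounded_op_lift F embed Q_K)
  next
    fix T assume "bounded_op (op_space C) whole T \<and>
        (\<forall>x. T (completion_embed (ran_ips C) (C x)) = f x)"
    then show "T = lift F"
      by (intro bounded_op_eq_lift[of T F "range Q"]) (auto simp: F embed Q_K K_def[symmetric])
  qed
  have J: "J_op C = lift Q" unfolding J_op_def by (rule extend[OF Q'(1) QQ])
  have S: "S_op C A = lift D"
    unfolding S_op_def by (rule extend[OF DE(1)]) (simp add: DE(3) R_def)
  \<comment> \<open>\<open>Q\<close> is symmetric with range inside \<open>K\<close>, so it serves
    as its own adjoint in the model.\<close>
  have J_adj: "J_adj C = (\<lambda>h. \<Phi> (Q h))"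
    unfolding J_adj_def J by (rule adjoint_op_lift[OF Q'(1) Q_K Q'(7)])
  have S_adj: "adjoint_op (op_space C) whole (S_op C A) = (\<lambda>h. \<Phi> (E h))"
    unfolding S
    by (rule adjoint_op_lift[OF DE(2,5) adjoint_bounded_clinear(2)[OF _ DE(2,4)]])
      (use DE(1) in \<open>simp add: bounded_clinear_def\<close>)
  have hat: "hat_op C A (\<Phi> k) = \<Phi> (E (D k))" if "k \<in> K" for k
    using that unfolding hat_op_def S_adj by (simp add: compose_def carrier_eq S)
  have id_minus: "id_minus (op_space C) (hat_op C A) (\<Phi> k) = \<Phi> (k - E (D k))" if "k \<in> K" for k
    using that by (simp add: id_minus_def carrier_eq hat vdiff DE(5))
  show ?thesis
  proof
    fix x
    have "(J_op C \<circ> hat_op C A \<circ> id_minus (op_space C) (hat_op C A) \<circ> J_adj C) x =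
        Q (E (D (Q x - E (D (Q x)))))"
      by (simp add: J J_adj id_minus hat Q_K DE(5) diff_closed)
    also have "\<dots> = R (R x - D (E (R x)))"
      using DE(1) by (simp add: QE DE(3) bounded_clinear_def linear_diff bounded_linear.linear)
    also have "\<dots> = P x"
      by (simp add: P_def linear_diff[OF R'(3)] RR)
    finally show "parallel_sum A B x =
        (J_op C \<circ> hat_op C A \<circ> id_minus (op_space C) (hat_op C A) \<circ> J_adj C) x"
      by (simp add: P)
  qed
qed

theorem corollary2p5:
  fixes A B :: "'h::complex_hilbert_space \<Rightarrow> 'h"
  assumes "positive_op A" and "positive_op B"
  shows "let C = (\<lambda>x. A x + B x); Ah = hat_op C A; Bh = hat_op C B in
           parallel_sum A B = J_op C \<circ> Ah \<circ> id_minus (op_space C) Ah \<circ> J_adj C \<and>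
           parallel_sum A B = J_op C \<circ> Bh \<circ> id_minus (op_space C) Bh \<circ> J_adj C"
  \<comment> \<open>The second identity is the first with \<open>A\<close> and \<open>B\<close>
    exchanged, which changes neither their sum nor their parallel sum.\<close>
  using parallel_sum_factorization[OF assms] parallel_sum_factorization[OF assms(2,1)]
  by (simp add: Let_def parallel_sum_commute[of A B] add.commute[of "A _" "B _"])

end
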